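(* Let $\{p_j\}_{j\in\mathbb{Z}_+}$ be an i.i.d. sequence in $[0,1]$ with law $\mathbb{P}$, and given $\{p_j\}$ let $X(i,j)$ be independent with $P(X(i,j)=1)=p_j=1-P(X(i,j)=0)$. Let $b=\operatorname{ess\,sup}_{\mathbb{P}}p$ and $\bar p=\mathbb{E}(p_0)$. Then for $x,y\in(0,\infty)$, $$\Psi_\rightarrow(x,y)\le bx+2\sqrt{\bar p(1-b)xy},$$ $$\Psi_\uparrow(x,y)\le\bar py+2\sqrt{\bar p(1-\bar p)xy},$$ $$\Psi(x,y)\le\bar py+4\sqrt{\bar p(1-\bar p)xy}+bx.$$
   Context: For $(k,\ell)\in\mathbb{Z}_+^2$: $\Pi_\rightarrow(k,\ell)$ is the set of paths $\{(0,y_0),(1,y_1),\dots,(k,y_k)\}$ with $0\le y_0\le\dots\le y_k\le\ell$; $\Pi_\uparrow(k,\ell)$ is the set of paths $\{(x_0,0),(x_1,1),\dots,(x_\ell,\ell)\}$ with $0\le x_0\le\dots\le x_\ell\le k$; $\Pi(k,\ell)$ is the set of nearest-neighbor paths from $(0,0)$ to $(k,\ell)$ with steps $(1,0)$ or $(0,1)$. $T_\rightarrow,T_\uparrow,T$ are the maxima of $\sum_{z\in\pi}X(z)$ over $\Pi_\rightarrow,\Pi_\uparrow,\Pi$ respectively, and $\Psi_\rightarrow,\Psi_\uparrow,\Psi$ are the almost sure limits of $n^{-1}T_\bullet(\lfloor nx\rfloor,\lfloor ny\rfloor)$. *)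

theory Defs
  imports "HOL-Probability.Probability"
begin

definition T_right :: "(nat \<Rightarrow> nat \<Rightarrow> real) \<Rightarrow> nat \<Rightarrow> nat \<Rightarrow> real" where
  "T_right w k l = Max {(\<Sum>i\<le>k. w i (y i)) | y.
      (\<forall>i<k. y i \<le> y (Suc i)) \<and> y k \<le> l}"

definition T_up :: "(nat \<Rightarrow> nat \<Rightarrow> real) \<Rightarrow> nat \<Rightarrow> nat \<Rightarrow> real" where
  "T_up w k l = Max {(\<Sum>j\<le>l. w (x j) j) | x.
      (\<forall>j<l. x j \<le> x (Suc j)) \<and> x l \<le> k}"

definition nn_path :: "nat \<Rightarrow> nat \<Rightarrow> (nat \<Rightarrow> nat \<times> nat) \<Rightarrow> bool" where
  "nn_path k l g \<longleftrightarrow> g 0 = (0, 0) \<and> g (k + l) = (k, l) \<and>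
     (\<forall>m < k + l. g (Suc m) = (fst (g m) + 1, snd (g m)) \<or>
                  g (Suc m) = (fst (g m), snd (g m) + 1))"

definition T_nn :: "(nat \<Rightarrow> nat \<Rightarrow> real) \<Rightarrow> nat \<Rightarrow> nat \<Rightarrow> real" where
  "T_nn w k l = Max {(\<Sum>m\<le>k + l. w (fst (g m)) (snd (g m))) | g. nn_path k l g}"

text \<open>Random environment: p j i.i.d. in [0,1]; conditionally on p, the X(i,j) are
  independent with P(X(i,j)=1) = p j = 1 - P(X(i,j)=0).  The conditional law is
  expressed through the joint law of (p, finitely many X's).\<close>
definition bernoulli_env ::
  "'a measure \<Rightarrow> (nat \<Rightarrow> 'a \<Rightarrow> real) \<Rightarrow> (nat \<Rightarrow> nat \<Rightarrow> 'a \<Rightarrow> real) \<Rightarrow> bool" where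
  "bernoulli_env M p X \<longleftrightarrow>
     prob_space M \<and>
     prob_space.indep_vars M (\<lambda>_. borel) p UNIV \<and>
     (\<forall>j. distr M borel (p j) = distr M borel (p 0)) \<and>
     (\<forall>j. \<forall>\<omega>\<in>space M. p j \<omega> \<in> {0..1}) \<and>
     (\<forall>i j. X i j \<in> borel_measurable M) \<and>
     (\<forall>S A (e :: nat \<times> nat \<Rightarrow> bool). finite S \<longrightarrow>
        A \<in> sets (Pi\<^sub>M UNIV (\<lambda>_. borel)) \<longrightarrow>
        measure M {\<omega> \<in> space M. (\<lambda>j. p j \<omega>) \<in> A \<and>
            (\<forall>z\<in>S. X (fst z) (snd z) \<omega> = (if e z then 1 else 0))}
        = (\<integral>\<omega>. indicator A (\<lambda>j. p j \<omega>) *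
              (\<Prod>z\<in>S. if e z then p (snd z) \<omega> else 1 - p (snd z) \<omega>) \<partial>M))"

end

theory Submission
  imports Defs
begin

text \<open>
  Let the weights be independent Bernoulli variables with parameters \<open>q i j\<close>. Suppose that
  \<open>a i\<close> and \<open>r j\<close> satisfy \<open>r j * a i * (1 - q i j) = q i j * (1 - a i)\<close>. Adding independent
  boundary increments, Bernoulli \<open>a i\<close> along the bottom and geometric of ratio \<open>r j\<close> along the
  left side, only increases \<open>T_right\<close>, and by a Burke-type property every row of the enlarged
  model again has independent Bernoulli \<open>a i\<close> increments. Hence the quenched expectation
  of \<open>T_right\<close> is at most the sum of the \<open>a i\<close> plus the sum of the \<open>r j / (1 - r j)\<close>.

  For \<open>Psi_right\<close> take \<open>a i\<close> constant and above \<open>b\<close>; \<open>T_up\<close> is \<open>T_right\<close> of the transposed weights,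
  and there one takes \<open>r j\<close> constant. Averaging over the environment, Fatou's lemma and
  optimisation over the free constant give the first two bounds. A nearest-neighbour path
  splits into the sites entered by a horizontal step and those entered by a vertical step,
  so \<open>Psi \<le> Psi_right + Psi_up\<close>, and \<open>pbar \<le> b\<close> gives the third.
\<close>

section \<open>Finite independent samples as list-valued pmfs\<close>

text \<open>Independent but not identically distributed entries. The list form lets laws of a row be
  transformed by induction on columns and by commuting \<open>bind_pmf\<close>.\<close>

primrec plist :: "'b pmf list \<Rightarrow> 'b list pmf" where
  "plist [] = return_pmf []"
| "plist (P # Ps) = bind_pmf P (\<lambda>x. map_pmf ((#) x) (plist Ps))"

lemma pmf_plist:
  assumes "length xs = length Ps"
  shows "pmf (plist Ps) xs = (\<Prod>i<length Ps. pmf (Ps ! i) (xs ! i))"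
  using assms
proof (induction Ps arbitrary: xs)
  case (Cons P Ps)
  then obtain x ys where xs: "xs = x # ys" and len: "length ys = length Ps"
    by (cases xs) auto
  \<comment> \<open>Written as an injective image of a product pmf, the head and the tail separate
    into two factors.\<close>
  have "plist (P # Ps) = map_pmf (\<lambda>(x, ys). x # ys) (pair_pmf P (plist Ps))"
    by (simp add: pair_pmf_def map_bind_pmf map_pmf_def bind_assoc_pmf bind_return_pmf)
  moreover have "inj (\<lambda>(x::'a, ys). x # ys)"
    by (auto simp: inj_on_def)
  ultimately have "pmf (plist (P # Ps)) xs = pmf P x * pmf (plist Ps) ys"
    using pmf_map_inj'[of "\<lambda>(x, ys). x # ys" "pair_pmf P (plist Ps)" "(x, ys)"]
    by (simp add: xs pmf_pair)
  then show ?case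
    by (simp add: Cons.IH[OF len] xs lessThan_Suc_eq_insert_0 prod.reindex)
qed simp

lemma set_pmf_plist_length: "xs \<in> set_pmf (plist Ps) \<Longrightarrow> length xs = length Ps"
  by (induction Ps arbitrary: xs) auto

lemma set_pmf_plist_nth:
  "xs \<in> set_pmf (plist Ps) \<Longrightarrow> i < length Ps \<Longrightarrow> xs ! i \<in> set_pmf (Ps ! i)"
  by (induction Ps arbitrary: xs i) (auto simp: nth_Cons split: nat.split)

lemma map_pmf_plist: "map_pmf (map f) (plist Ps) = plist (map (map_pmf f) Ps)"
proof (induction Ps)
  case (Cons P Ps)
  have "map_pmf (map f) (plist (P # Ps)) =
      bind_pmf P (\<lambda>x. map_pmf ((#) (f x)) (map_pmf (map f) (plist Ps)))"
    by (simp add: map_bind_pmf pmf.map_comp o_def)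
  then show ?case
    by (simp add: Cons.IH bind_map_pmf)
qed simp

section \<open>The Burke property, for one site and for a row\<close>

text \<open>
  For \<open>G(i,j) = max (G(i,j-1)) (G(i-1,j) + X(i,j))\<close> let \<open>I\<close> be the horizontal increment of \<open>G\<close> below the
  site and \<open>J\<close> the vertical increment to its left; the two functions give the increments above
  and to the right. In queueing terms \<open>J\<close> is the queue length, \<open>X\<close> an arrival, \<open>I\<close> a service.
\<close>
definition step_I :: "nat \<Rightarrow> bool \<Rightarrow> bool \<Rightarrow> bool" where
  "step_I J I X \<longleftrightarrow> X \<or> (I \<and> J = 0)"

definition step_J :: "nat \<Rightarrow> bool \<Rightarrow> bool \<Rightarrow> nat" where
  "step_J J I X = J + of_bool X - of_bool I"

lemma step_conservation: "of_bool I + step_J J I X = J + of_bool (step_I J I X)"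
  by (cases I; cases X) (auto simp: step_I_def step_J_def)

text \<open>The equation \<open>bal\<close> is detailed balance for the queue length: a step up has
  probability \<open>q * (1 - a)\<close>, a step down \<open>a * (1 - q)\<close>, so the geometric
  law of ratio \<open>r\<close> is stationary. That the outgoing pair is again independent is
  checked point by point.\<close>

lemma step_law:
  fixes a q r :: real
  assumes a: "0 \<le> a" "a \<le> 1" and q: "0 \<le> q" "q \<le> 1" and r: "0 \<le> r" "r < 1"
    and bal: "r * a * (1 - q) = q * (1 - a)"
  shows "bind_pmf (bernoulli_pmf a) (\<lambda>I. bind_pmf (bernoulli_pmf q) (\<lambda>X.
           map_pmf (\<lambda>J. (step_I J I X, step_J J I X)) (geometric_pmf (1 - r)))) =
         pair_pmf (bernoulli_pmf a) (geometric_pmf (1 - r))"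
proof (rule pmf_eqI)
  fix z :: "bool \<times> nat"
  obtain i m where z: "z = (i, m)" by (cases z)
  let ?g = "geometric_pmf (1 - r)"
  have g: "pmf ?g n = r ^ n * (1 - r)" for n
    using r by (subst pmf_geometric) auto
  \<comment> \<open>The letters are the values of \<open>I\<close> and \<open>X\<close>. For each
    pair at most one \<open>J\<close> is sent to \<open>(i, m)\<close>, so the mass of
    \<open>(i, m)\<close> is a sum of four point masses. In \<open>TF\<close> an empty queue wastes
    the service, which produces the outcome \<open>(True, 0)\<close>.\<close>
  have FF: "(\<lambda>J. (step_I J False False, step_J J False False)) -` {(i, m)} = (if i then {} else {m})"
    by (auto simp: step_I_def step_J_def)
  have TT: "(\<lambda>J. (step_I J True True, step_J J True True)) -` {(i, m)} = (if i then {m} else {})"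
    by (auto simp: step_I_def step_J_def)
  have TF: "(\<lambda>J. (step_I J True False, step_J J True False)) -` {(i, m)} =
      (if i then (if m = 0 then {0} else {}) else {Suc m})"
    by (auto simp: step_I_def step_J_def)
  have FT: "(\<lambda>J. (step_I J False True, step_J J False True)) -` {(i, m)} =
      (if i \<and> m > 0 then {m - 1} else {})"
    by (auto simp: step_I_def step_J_def)
  have "pmf (bind_pmf (bernoulli_pmf a) (\<lambda>I. bind_pmf (bernoulli_pmf q) (\<lambda>X.
           map_pmf (\<lambda>J. (step_I J I X, step_J J I X)) ?g))) z =
        a * (q * (if i then pmf ?g m else 0) +
             (1 - q) * (if i then (if m = 0 then pmf ?g 0 else 0) else pmf ?g (Suc m))) +
        (1 - a) * (q * (if i \<and> m > 0 then pmf ?g (m - 1) else 0) +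
             (1 - q) * (if i then 0 else pmf ?g m))"
    using a q by (simp add: pmf_bind pmf_map z FF TT TF FT measure_pmf_single)
  also have "\<dots> = pmf (bernoulli_pmf a) i * pmf ?g m"
  proof (cases i)
    case False
    \<comment> \<open>Up to the common factor \<open>r ^ m * (1 - r)\<close> the claim is this
      rearrangement of \<open>bal\<close>.\<close>
    have "a * (1 - q) * r + (1 - a) * (1 - q) = 1 - a"
      using bal by (simp add: algebra_simps)
    then have "(a * (1 - q) * r + (1 - a) * (1 - q)) * r ^ m * (1 - r) = (1 - a) * r ^ m * (1 - r)"
      by simp
    then show ?thesis
      using False a by (simp add: g algebra_simps)
  next
    case True
    show ?thesis
    proof (cases m)
      case 0
      then show ?thesis using True a by (simp add: g algebra_simps)
    next
      case (Suc n)
      have "a * q * r + (1 - a) * q = a * r"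
        using bal by (simp add: algebra_simps)
      then have "(a * q * r + (1 - a) * q) * r ^ n * (1 - r) = a * r * r ^ n * (1 - r)"
        by simp
      then show ?thesis using True a Suc by (simp add: g algebra_simps)
    qed
  qed
  finally show "pmf (bind_pmf (bernoulli_pmf a) (\<lambda>I. bind_pmf (bernoulli_pmf q) (\<lambda>X.
           map_pmf (\<lambda>J. (step_I J I X, step_J J I X)) ?g))) z =
        pmf (pair_pmf (bernoulli_pmf a) ?g) z"
    by (simp add: z pmf_pair)
qed

text \<open>\<open>J\<close> is the vertical increment entering the row from the left. The one
  leaving on the right is dropped, since the corner value is computed by going up the left side and
  then along the top.\<close>

fun row :: "nat \<Rightarrow> bool list \<Rightarrow> bool list \<Rightarrow> bool list" where
  "row J (I # Is) (X # Xs) = step_I J I X # row (step_J J I X) Is Xs"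
| "row J _ _ = []"

text \<open>By \<open>step_law\<close> the first site emits a Bernoulli \<open>a\<close> increment
  upwards and, independently of it, a fresh geometric increment to the right, so the remaining
  columns are in the same situation.\<close>

lemma row_law:
  fixes as qs :: "real list" and r :: real
  assumes "length as = length qs" and r: "0 \<le> r" "r < 1"
    and "\<And>i. i < length as \<Longrightarrow> as ! i \<in> {0..1} \<and> qs ! i \<in> {0..1} \<and>
           r * (as ! i) * (1 - qs ! i) = qs ! i * (1 - as ! i)"
  shows "bind_pmf (plist (map bernoulli_pmf as)) (\<lambda>Is. bind_pmf (geometric_pmf (1 - r)) (\<lambda>J.
           map_pmf (row J Is) (plist (map bernoulli_pmf qs)))) = plist (map bernoulli_pmf as)"
  using assms(1,4)
proof (induction as qs rule: list_induct2)
  case Nil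
  then show ?case by (simp add: bind_return_pmf)
next
  case (Cons a as q qs)
  let ?g = "geometric_pmf (1 - r)"
  let ?A = "plist (map bernoulli_pmf as)" and ?Q = "plist (map bernoulli_pmf qs)"
  have IH: "bind_pmf ?A (\<lambda>Is. bind_pmf ?g (\<lambda>J. map_pmf (row J Is) ?Q)) = ?A"
  proof (rule Cons.IH)
    fix i assume "i < length as"
    then show "as ! i \<in> {0..1} \<and> qs ! i \<in> {0..1} \<and>
        r * as ! i * (1 - qs ! i) = qs ! i * (1 - as ! i)"
      using Cons.prems[of "Suc i"] by simp
  qed
  have hd: "a \<in> {0..1}" "q \<in> {0..1}" "r * a * (1 - q) = q * (1 - a)"
    using Cons.prems[of 0] by auto
  \<comment> \<open>\<open>K\<close> completes the row after its first site. It sees that site only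
    through the two outgoing increments; once the independent samples are reordered so that
    \<open>I\<close>, \<open>X\<close>, \<open>J\<close> are drawn in this order,
    \<open>step_law\<close> can be substituted.\<close>
  define K where "K = (\<lambda>(I', J'). bind_pmf ?A (\<lambda>Is. map_pmf (\<lambda>Xs. I' # row J' Is Xs) ?Q))"
  have "bind_pmf (plist (map bernoulli_pmf (a # as))) (\<lambda>Is. bind_pmf ?g (\<lambda>J.
           map_pmf (row J Is) (plist (map bernoulli_pmf (q # qs))))) =
        bind_pmf (bernoulli_pmf a) (\<lambda>I. bind_pmf ?A (\<lambda>Is. bind_pmf ?g (\<lambda>J.
          bind_pmf (bernoulli_pmf q) (\<lambda>X.
           map_pmf (\<lambda>Xs. step_I J I X # row (step_J J I X) Is Xs) ?Q))))"
    by (simp add: bind_assoc_pmf bind_map_pmf map_bind_pmf pmf.map_comp o_def)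
  also have "\<dots> = bind_pmf (bernoulli_pmf a) (\<lambda>I. bind_pmf ?g (\<lambda>J. bind_pmf ?A (\<lambda>Is.
          bind_pmf (bernoulli_pmf q) (\<lambda>X.
           map_pmf (\<lambda>Xs. step_I J I X # row (step_J J I X) Is Xs) ?Q))))"
    by (rule bind_pmf_cong[OF refl], rule bind_commute_pmf)
  also have "\<dots> = bind_pmf (bernoulli_pmf a) (\<lambda>I. bind_pmf ?g (\<lambda>J. 
          bind_pmf (bernoulli_pmf q) (\<lambda>X. K (step_I J I X, step_J J I X))))"
    unfolding K_def prod.case by (rule bind_pmf_cong[OF refl], rule bind_pmf_cong[OF refl], rule bind_commute_pmf)
  also have "\<dots> = bind_pmf (bernoulli_pmf a) (\<lambda>I. bind_pmf (bernoulli_pmf q) (\<lambda>X.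
          bind_pmf ?g (\<lambda>J. K (step_I J I X, step_J J I X))))"
    by (rule bind_pmf_cong[OF refl], rule bind_commute_pmf)
  also have "\<dots> = bind_pmf (bind_pmf (bernoulli_pmf a) (\<lambda>I. bind_pmf (bernoulli_pmf q) (\<lambda>X.
          map_pmf (\<lambda>J. (step_I J I X, step_J J I X)) ?g))) K"
    by (simp add: bind_assoc_pmf bind_map_pmf)
  also have "\<dots> = bind_pmf (pair_pmf (bernoulli_pmf a) ?g) K"
    using hd r by (subst step_law) auto
  also have "\<dots> = bind_pmf (bernoulli_pmf a) (\<lambda>I'. bind_pmf ?g (\<lambda>J'.
          bind_pmf ?A (\<lambda>Is. map_pmf (\<lambda>Xs. I' # row J' Is Xs) ?Q)))"
    by (simp add: pair_pmf_def bind_assoc_pmf bind_return_pmf K_def)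
  also have "\<dots> = bind_pmf (bernoulli_pmf a) (\<lambda>I'. map_pmf ((#) I')
          (bind_pmf ?A (\<lambda>Is. bind_pmf ?g (\<lambda>J'. map_pmf (row J' Is) ?Q))))"
    unfolding map_bind_pmf pmf.map_comp o_def
    by (rule bind_pmf_cong[OF refl], rule bind_commute_pmf)
  also have "\<dots> = plist (map bernoulli_pmf (a # as))"
    by (simp add: IH)
  finally show ?case .
qed

section \<open>Expected corner value of the model with boundary\<close>

text \<open>Value at the upper right corner of \<open>G\<close> with bottom increments \<open>Is\<close>, where each list entry
  consists of the left boundary increment and the weights of one row, bottom row first.\<close>
fun total :: "(nat \<times> bool list) list \<Rightarrow> bool list \<Rightarrow> nat" where
  "total [] Is = (\<Sum>I\<leftarrow>Is. of_bool I)"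
| "total ((J, Xs) # R) Is = J + total R (row J Is Xs)"

lemma nn_integral_geometric_pmf:
  assumes "0 \<le> r" "r < 1"
  shows "(\<integral>\<^sup>+J. ennreal (real J) \<partial>geometric_pmf (1 - r)) = ennreal (r / (1 - r))"
  using assms expectation_geometric_pmf[of "1 - r"] integrable_real_geometric_pmf[of "1 - r"]
  by (subst nn_integral_eq_integral) auto

lemma nn_integral_plist_bernoulli_sum:
  assumes "\<And>a. a \<in> set as \<Longrightarrow> a \<in> {0..1}"
  shows "(\<integral>\<^sup>+Is. ennreal (real (\<Sum>I\<leftarrow>Is. of_bool I)) \<partial>plist (map bernoulli_pmf as)) =
         ennreal (sum_list as)"
  using assms
proof (induction as)
  case (Cons a as)
  have a: "0 \<le> a" "a \<le> 1" using Cons.prems[of a] by auto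
  have "(\<integral>\<^sup>+Is. ennreal (real (\<Sum>I\<leftarrow>Is. of_bool I)) \<partial>plist (map bernoulli_pmf (a # as))) =
     (\<integral>\<^sup>+I. ennreal (of_bool I) +
        (\<integral>\<^sup>+Is. ennreal (real (\<Sum>I\<leftarrow>Is. of_bool I)) \<partial>plist (map bernoulli_pmf as)) \<partial>bernoulli_pmf a)"
    by (simp add: nn_integral_add)
  also have "\<dots> = (\<integral>\<^sup>+I. ennreal (of_bool I) + ennreal (sum_list as) \<partial>bernoulli_pmf a)"
    using Cons by simp
  also have "\<dots> = ennreal a + ennreal (sum_list as)"
    using a by (simp add: nn_integral_add)
  also have "\<dots> = ennreal (sum_list (a # as))"
    using a Cons.prems by (subst ennreal_plus[symmetric]) (auto intro!: sum_list_nonneg)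
  finally show ?case .
qed simp

text \<open>The bottom row contributes the mean \<open>r / (1 - r)\<close> of its left increment
  and, by \<open>row_law\<close>, passes a list with unchanged law to the rows above.\<close>

lemma nn_integral_total:
  fixes as :: "real list" and rows :: "(real list \<times> real) list"
  assumes as: "\<And>a. a \<in> set as \<Longrightarrow> a \<in> {0..1}"
    and "\<And>qs r. (qs, r) \<in> set rows \<Longrightarrow> 0 \<le> r \<and> r < 1 \<and> length qs = length as"
    and "\<And>qs r i. (qs, r) \<in> set rows \<Longrightarrow> i < length as \<Longrightarrow>
           qs ! i \<in> {0..1} \<and> r * (as ! i) * (1 - qs ! i) = qs ! i * (1 - as ! i)"
  shows "(\<integral>\<^sup>+Is. \<integral>\<^sup>+R. ennreal (real (total R Is)) 
             \<partial>plist (map (\<lambda>(qs, r). pair_pmf (geometric_pmf (1 - r)) (plist (map bernoulli_pmf qs))) rows)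
             \<partial>plist (map bernoulli_pmf as)) =
         ennreal (sum_list as + (\<Sum>(qs, r)\<leftarrow>rows. r / (1 - r)))"
  using assms(2,3)
proof (induction rows)
  case Nil
  then show ?case
    using nn_integral_plist_bernoulli_sum[OF as] by simp
next
  case (Cons qr rows)
  obtain qs r where qr: "qr = (qs, r)" by (cases qr)
  let ?P = "plist (map (\<lambda>(qs, r). pair_pmf (geometric_pmf (1 - r)) (plist (map bernoulli_pmf qs))) rows)"
  let ?A = "plist (map bernoulli_pmf as)" and ?Q = "plist (map bernoulli_pmf qs)"
  let ?g = "geometric_pmf (1 - r)"
  define h where "h = (\<lambda>Is. \<integral>\<^sup>+R. ennreal (real (total R Is)) \<partial>?P)"
  have IH: "(\<integral>\<^sup>+Is. h Is \<partial>?A) = ennreal (sum_list as + (\<Sum>(qs, r)\<leftarrow>rows. r / (1 - r)))"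
    unfolding h_def by (intro Cons.IH Cons.prems) auto
  have r: "0 \<le> r" "r < 1" and len: "length as = length qs"
    using Cons.prems(1)[of qs r] by (auto simp: qr)
  have rl: "bind_pmf ?A (\<lambda>Is. bind_pmf ?g (\<lambda>J. map_pmf (row J Is) ?Q)) = ?A"
    using Cons.prems(2)[of qs r] as by (intro row_law len r) (auto simp: qr)
  have "(\<integral>\<^sup>+Is. \<integral>\<^sup>+R. ennreal (real (total R Is)) 
      \<partial>plist (map (\<lambda>(qs, r). pair_pmf (geometric_pmf (1 - r)) (plist (map bernoulli_pmf qs))) (qr # rows))
      \<partial>?A) = (\<integral>\<^sup>+Is. \<integral>\<^sup>+J. \<integral>\<^sup>+Xs. ennreal (real J) + h (row J Is Xs) \<partial>?Q \<partial>?g \<partial>?A)"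
    by (simp add: qr nn_integral_pair_pmf' h_def nn_integral_add)
  also have "\<dots> = ennreal (r / (1 - r)) + (\<integral>\<^sup>+Is. \<integral>\<^sup>+J. \<integral>\<^sup>+Xs. h (row J Is Xs) \<partial>?Q \<partial>?g \<partial>?A)"
    using nn_integral_geometric_pmf[OF r] by (simp add: nn_integral_add)
  also have "(\<integral>\<^sup>+Is. \<integral>\<^sup>+J. \<integral>\<^sup>+Xs. h (row J Is Xs) \<partial>?Q \<partial>?g \<partial>?A) =
      (\<integral>\<^sup>+Is. h Is \<partial>bind_pmf ?A (\<lambda>Is. bind_pmf ?g (\<lambda>J. map_pmf (row J Is) ?Q)))"
    by simp
  also have "\<dots> = ennreal (sum_list as + (\<Sum>(qs, r)\<leftarrow>rows. r / (1 - r)))"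
    unfolding rl by (rule IH)
  also have "ennreal (r / (1 - r)) + \<dots> = ennreal (sum_list as + (\<Sum>(qs, r)\<leftarrow>(qr # rows). r / (1 - r)))"
  proof -
    have "0 \<le> sum_list as" using as by (auto intro!: sum_list_nonneg)
    moreover have "0 \<le> (\<Sum>(qs, r)\<leftarrow>rows. r / (1 - r))"
      using Cons.prems(1) by (force intro!: sum_list_nonneg)
    ultimately show ?thesis using r by (subst ennreal_plus[symmetric]) (auto simp: qr)
  qed
  finally show ?case .
qed

section \<open>Domination of path sums by the model with boundary\<close>

lemma length_row: "length (row J Is Xs) = min (length Is) (length Xs)"
  by (induction J Is Xs rule: row.induct) auto

lemma row_ge: "i < length Is \<Longrightarrow> i < length Xs \<Longrightarrow> Xs ! i \<Longrightarrow> row J Is Xs ! i"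
  by (induction J Is Xs arbitrary: i rule: row.induct) (auto simp: nth_Cons step_I_def split: nat.splits)

text \<open>\<open>step_conservation\<close> telescopes along the row, and the vertical increment to
  the right of the first \<open>m\<close> columns is non-negative.\<close>

lemma row_sum_ge:
  "m \<le> length Is \<Longrightarrow> m \<le> length Xs \<Longrightarrow>
   (\<Sum>i<m. of_bool (Is ! i)) \<le> J + (\<Sum>i<m. of_bool (row J Is Xs ! i) :: nat)"
proof (induction J Is Xs arbitrary: m rule: row.induct)
  case (1 J I Is X Xs)
  show ?case
  proof (cases m)
    case (Suc n)
    have "(\<Sum>i<n. of_bool (Is ! i)) \<le> step_J J I X + (\<Sum>i<n. of_bool (row (step_J J I X) Is Xs ! i) :: nat)"
      using 1 Suc by auto
    then show ?thesis
      using step_conservation[of I J X]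
      by (simp add: Suc sum.lessThan_Suc_shift del: sum.lessThan_Suc sum_of_bool_eq)
  qed simp
qed simp_all

text \<open>The path is entered at column \<open>m\<close>; before that the bottom boundary is followed. This
  generalisation makes the induction over rows work.\<close>
lemma path_sum_le_total:
  assumes "\<And>J Xs. (J, Xs) \<in> set R \<Longrightarrow> length Xs = length Is"
    and "m \<le> length Is"
    and "\<And>i. m \<le> i \<Longrightarrow> i < length Is \<Longrightarrow> y i < length R"
    and "\<And>i j. m \<le> i \<Longrightarrow> i \<le> j \<Longrightarrow> j < length Is \<Longrightarrow> y i \<le> y j"
  shows "(\<Sum>i<m. of_bool (Is ! i)) + (\<Sum>i=m..<length Is. of_bool (snd (R ! y i) ! i)) \<le> total R Is"
  using assms
proof (induction R arbitrary: Is m y)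
  case Nil
  \<comment> \<open>With no rows left, \<open>y i < length []\<close> is impossible, so there is no
    column from \<open>m\<close> on.\<close>
  then have "m = length Is"
    by (metis le_neq_implies_less le_refl less_nat_zero_code list.size(3))
  then show ?case
    by (simp add: sum_list_sum_nth atLeast0LessThan del: sum_of_bool_eq)
next
  case (Cons JX R)
  obtain J Xs where JX: "JX = (J, Xs)" by (cases JX)
  let ?k = "length Is"
  have len: "length Xs = ?k" using Cons.prems(1) by (auto simp: JX)
  \<comment> \<open>The column where the path leaves the bottom row, or the end of the row. Above
    that row the induction hypothesis applies to the path \<open>y i - 1\<close> entered at
    \<open>m'\<close>.\<close>
  define m' where "m' = (LEAST i. m \<le> i \<and> (i = ?k \<or> 0 < y i))"
  have m': "m \<le> m' \<and> (m' = ?k \<or> 0 < y m')"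
    unfolding m'_def by (rule LeastI[of _ ?k]) (use Cons.prems in auto)
  have m'k: "m' \<le> ?k"
    unfolding m'_def by (rule Least_le) (use Cons.prems in auto)
  have zero: "y i = 0" if "m \<le> i" "i < m'" for i
    using not_less_Least[of i "\<lambda>i. m \<le> i \<and> (i = ?k \<or> 0 < y i)"] that unfolding m'_def by auto
  have pos: "0 < y i" if "m' \<le> i" "i < ?k" for i
    using m' that Cons.prems(4)[of m' i] by auto
  let ?Is = "row J Is Xs"
  have len': "length ?Is = ?k" by (simp add: length_row len)
  have IH: "(\<Sum>i<m'. of_bool (?Is ! i)) + (\<Sum>i=m'..<?k. of_bool (snd (R ! (y i - 1)) ! i)) \<le> total R ?Is"
    unfolding len'[symmetric]
  proof (rule Cons.IH)
    show "length Xs' = length ?Is" if "(J', Xs') \<in> set R" for J' Xs'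
      using that Cons.prems(1)[of J' Xs'] by (simp add: len')
    show "m' \<le> length ?Is" by (simp add: len' m'k)
    show "y i - 1 < length R" if "m' \<le> i" "i < length ?Is" for i
      using that pos[of i] Cons.prems(3)[of i] m' by (auto simp: len')
    show "y i - 1 \<le> y j - 1" if "m' \<le> i" "i \<le> j" "j < length ?Is" for i j
      using that Cons.prems(4)[of i j] m' by (auto simp: len')
  qed
  \<comment> \<open>Three stretches are compared with the new bottom increments: before
    \<open>m\<close> lifting the boundary costs at most \<open>J\<close>, between \<open>m\<close>
    and \<open>m'\<close> each collected weight is at most the increment above it, and from
    \<open>m'\<close> on only the row index shifts.\<close>
  have "(\<Sum>i<m. of_bool (Is ! i)) \<le> J + (\<Sum>i<m. of_bool (?Is ! i) :: nat)"
    by (rule row_sum_ge) (use Cons.prems len in auto)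
  moreover have "(\<Sum>i=m..<m'. of_bool (snd ((JX # R) ! y i) ! i)) \<le> (\<Sum>i=m..<m'. of_bool (?Is ! i) :: nat)"
    using m'k len by (intro sum_mono) (auto simp: zero JX intro: row_ge)
  moreover have "(\<Sum>i=m'..<?k. of_bool (snd ((JX # R) ! y i) ! i)) =
      (\<Sum>i=m'..<?k. of_bool (snd (R ! (y i - 1)) ! i) :: nat)"
    using pos by (intro sum.cong refl) (auto simp: nth_Cons')
  moreover have "(\<Sum>i=m..<?k. of_bool (snd ((JX # R) ! y i) ! i)) =
      (\<Sum>i=m..<m'. of_bool (snd ((JX # R) ! y i) ! i)) + (\<Sum>i=m'..<?k. of_bool (snd ((JX # R) ! y i) ! i) :: nat)"
    using m' m'k by (simp add: sum.atLeastLessThan_concat del: sum_of_bool_eq)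
  moreover have "(\<Sum>i<m'. of_bool (?Is ! i)) = (\<Sum>i<m. of_bool (?Is ! i)) + (\<Sum>i=m..<m'. of_bool (?Is ! i) :: nat)"
    using m' by (simp add: sum.atLeastLessThan_concat lessThan_atLeast0 del: sum_of_bool_eq)
  ultimately show ?case
    using IH by (simp add: JX del: sum_of_bool_eq)
qed

section \<open>Path maxima: finiteness, extension, and nearest-neighbour paths\<close>

definition right_path :: "nat \<Rightarrow> nat \<Rightarrow> (nat \<Rightarrow> nat) \<Rightarrow> bool" where
  "right_path k l y \<longleftrightarrow> (\<forall>i<k. y i \<le> y (Suc i)) \<and> y k \<le> l"

lemma T_right_eq: "T_right w k l = Max {(\<Sum>i\<le>k. w i (y i)) | y. right_path k l y}"
  by (simp add: T_right_def right_path_def)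

lemma right_path_mono:
  assumes "right_path k l y" "i \<le> j" "j \<le> k"
  shows "y i \<le> y j"
  using assms(2,3,1)
proof (induction rule: dec_induct)
  case (step n)
  then have "y i \<le> y n" "y n \<le> y (Suc n)" by (auto simp: right_path_def)
  then show ?case by simp
qed simp

lemma right_path_le: "right_path k l y \<Longrightarrow> i \<le> k \<Longrightarrow> y i \<le> l"
  using right_path_mono[of k l y i k] by (auto simp: right_path_def)

text \<open>The functions \<open>y\<close> are unconstrained beyond \<open>k\<close>, hence
  infinitely many; the sum depends only on the restriction to \<open>{..k}\<close>, which ranges
  over a finite set.\<close>

lemma finite_right_path_sums: "finite {(\<Sum>i\<le>k. w i (y i)) | y. right_path k l y}"
proof (rule finite_subset)
  show "finite ((\<lambda>y. \<Sum>i\<le>k. w i (y i)) ` (PiE {..k} (\<lambda>_. {..l})))"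
    by (intro finite_imageI finite_PiE) auto
  show "{(\<Sum>i\<le>k. w i (y i)) | y. right_path k l y} \<subseteq> (\<lambda>y. \<Sum>i\<le>k. w i (y i)) ` (PiE {..k} (\<lambda>_. {..l}))"
  proof safe
    fix y assume "right_path k l y"
    then have "restrict y {..k} \<in> PiE {..k} (\<lambda>_. {..l})"
      by (auto simp: right_path_le)
    then show "(\<Sum>i\<le>k. w i (y i)) \<in> (\<lambda>y. \<Sum>i\<le>k. w i (y i)) ` (PiE {..k} (\<lambda>_. {..l}))"
      by (intro image_eqI[where x = "restrict y {..k}"]) auto
  qed
qed

lemma T_right_ge: "right_path k l y \<Longrightarrow> (\<Sum>i\<le>k. w i (y i)) \<le> T_right w k l"
  unfolding T_right_eq by (rule Max_ge[OF finite_right_path_sums]) auto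

lemma ex_T_right: "\<exists>y. right_path k l y \<and> T_right w k l = (\<Sum>i\<le>k. w i (y i))"
proof -
  have "right_path k l (\<lambda>_. 0)" by (simp add: right_path_def)
  then have "{(\<Sum>i\<le>k. w i (y i)) | y. right_path k l y} \<noteq> {}" by blast
  from Max_in[OF finite_right_path_sums this] show ?thesis
    unfolding T_right_eq by auto
qed

lemma T_right_le:
  assumes "\<And>y. right_path k l y \<Longrightarrow> (\<Sum>i\<le>k. w i (y i)) \<le> c"
  shows "T_right w k l \<le> c"
  using ex_T_right[of k l w] assms by metis

lemma T_right_cong:
  assumes "\<And>i j. i \<le> k \<Longrightarrow> j \<le> l \<Longrightarrow> w i j = w' i j"
  shows "T_right w k l = T_right w' k l"
proof -
  have "(\<Sum>i\<le>k. w i (y i)) = (\<Sum>i\<le>k. w' i (y i))" if "right_path k l y" for y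
    using that by (intro sum.cong refl assms) (auto simp: right_path_le)
  then show ?thesis
    by (intro antisym T_right_le) (metis T_right_ge)+
qed

lemma T_up_eq_T_right: "T_up w k l = T_right (\<lambda>i j. w j i) l k"
  by (simp add: T_up_def T_right_def)

text \<open>An optimal path stays at height at most \<open>l\<close>, so it may be continued by the
  site \<open>(Suc k, l)\<close>. This is what a horizontal step of a nearest-neighbour path
  uses.\<close>

lemma T_right_extend: "T_right w k l + w (Suc k) l \<le> T_right w (Suc k) l"
proof -
  obtain y where y: "right_path k l y" "T_right w k l = (\<Sum>i\<le>k. w i (y i))"
    using ex_T_right by blast
  let ?y = "y(Suc k := l)"
  have "right_path (Suc k) l ?y"
    using y(1) by (auto simp: right_path_def less_Suc_eq)
  from T_right_ge[OF this, of w] show ?thesis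
    by (simp add: y(2))
qed

lemma T_right_mono_height: "l \<le> l' \<Longrightarrow> T_right w k l \<le> T_right w k l'"
  by (rule T_right_le, rule T_right_ge) (auto simp: right_path_def)

lemma T_up_extend: "T_up w k l + w k (Suc l) \<le> T_up w k (Suc l)"
  unfolding T_up_eq_T_right by (rule T_right_extend[of "\<lambda>i j. w j i"])

lemma T_up_mono_width: "k \<le> k' \<Longrightarrow> T_up w k l \<le> T_up w k' l"
  unfolding T_up_eq_T_right by (rule T_right_mono_height)

text \<open>A horizontal step adds its site to a \<open>T_right\<close> path while
  \<open>T_up\<close> can only grow with the width; for a vertical step the roles are
  exchanged.\<close>

lemma nn_path_sum_le:
  assumes g: "nn_path k l g" and w: "0 \<le> w 0 0" and n: "n \<le> k + l"
  shows "(\<Sum>m\<le>n. w (fst (g m)) (snd (g m))) \<le>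
    T_right w (fst (g n)) (snd (g n)) + T_up w (fst (g n)) (snd (g n))"
  using n
proof (induction n)
  case 0
  \<comment> \<open>The origin is entered by no step and is counted in both maxima, hence the sign
    condition on \<open>w 0 0\<close>.\<close>
  have "w 0 0 \<le> T_right w 0 0" "w 0 0 \<le> T_up w 0 0"
    using T_right_ge[of 0 0 "\<lambda>_. 0" w] T_right_ge[of 0 0 "\<lambda>_. 0" "\<lambda>i j. w j i"]
    by (auto simp: T_up_eq_T_right right_path_def)
  then show ?case using w g by (simp add: nn_path_def)
next
  case (Suc n)
  then have IH: "(\<Sum>m\<le>n. w (fst (g m)) (snd (g m))) \<le>
    T_right w (fst (g n)) (snd (g n)) + T_up w (fst (g n)) (snd (g n))" by simp
  consider "g (Suc n) = (Suc (fst (g n)), snd (g n))" | "g (Suc n) = (fst (g n), Suc (snd (g n)))"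
    using g Suc.prems unfolding nn_path_def by (metis Suc_eq_plus1 Suc_le_lessD)
  then show ?case
  proof cases
    case 1
    then show ?thesis
      using IH T_right_extend[of w "fst (g n)" "snd (g n)"]
        T_up_mono_width[of "fst (g n)" "Suc (fst (g n))" w "snd (g n)"] by simp
  next
    case 2
    then show ?thesis
      using IH T_up_extend[of w "fst (g n)" "snd (g n)"]
        T_right_mono_height[of "snd (g n)" "Suc (snd (g n))" w "fst (g n)"] by simp
  qed
qed

lemma ex_nn_path: "\<exists>g. nn_path k l g"
  by (rule exI[of _ "\<lambda>m. (min m k, m - k)"]) (auto simp: nn_path_def min_def)

lemma nn_path_coord_sum:
  assumes g: "nn_path k l g" and "m \<le> k + l"
  shows "fst (g m) + snd (g m) = m"
  using assms(2)
proof (induction m)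
  case (Suc m)
  then show ?case using g unfolding nn_path_def by (metis Suc_le_lessD Suc_leD add.commute add_Suc_right fst_conv snd_conv plus_1_eq_Suc)
qed (use g in \<open>simp add: nn_path_def\<close>)

lemma T_nn_le:
  assumes w: "0 \<le> w 0 0"
  shows "T_nn w k l \<le> T_right w k l + T_up w k l"
proof -
  let ?A = "{(\<Sum>m\<le>k + l. w (fst (g m)) (snd (g m))) | g. nn_path k l g}"
  \<comment> \<open>By \<open>nn_path_coord_sum\<close> both coordinates stay at most
    \<open>k + l\<close> along the path, so only finitely many restricted paths occur.\<close>
  let ?B = "PiE {..k + l} (\<lambda>_. {..k + l} \<times> {..k + l})"
  have "finite ?A"
  proof (rule finite_subset)
    show "finite ((\<lambda>g. \<Sum>m\<le>k + l. w (fst (g m)) (snd (g m))) ` ?B)"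
      by (intro finite_imageI finite_PiE) auto
    show "?A \<subseteq> (\<lambda>g. \<Sum>m\<le>k + l. w (fst (g m)) (snd (g m))) ` ?B"
    proof safe
      fix g assume g: "nn_path k l g"
      have "g m \<in> {..k + l} \<times> {..k + l}" if "m \<le> k + l" for m
        using nn_path_coord_sum[OF g that] that by (simp add: mem_Times_iff)
      then have "restrict g {..k + l} \<in> ?B" by auto
      then show "(\<Sum>m\<le>k + l. w (fst (g m)) (snd (g m))) \<in> (\<lambda>g. \<Sum>m\<le>k + l. w (fst (g m)) (snd (g m))) ` ?B"
        by (intro image_eqI[where x = "restrict g {..k + l}"]) auto
    qed
  qed
  moreover have "?A \<noteq> {}" using ex_nn_path by blast
  moreover have "(\<Sum>m\<le>k + l. w (fst (g m)) (snd (g m))) \<le> T_right w k l + T_up w k l"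
    if "nn_path k l g" for g
    using nn_path_sum_le[OF that, of w "k + l"] w that by (simp add: nn_path_def)
  ultimately show ?thesis
    unfolding T_nn_def by (subst Max_le_iff) auto
qed

section \<open>Boolean weight tables and the quenched bound\<close>

text \<open>The row index comes first: entry \<open>! j ! i\<close> belongs to site
  \<open>(i, j)\<close>, which matches the row-by-row input of \<open>total\<close>.\<close>

definition mat :: "nat \<Rightarrow> nat \<Rightarrow> (nat \<Rightarrow> nat \<Rightarrow> 'b) \<Rightarrow> 'b list list" where
  "mat k l w = map (\<lambda>j. map (\<lambda>i. w i j) [0..<Suc k]) [0..<Suc l]"

definition matrices :: "nat \<Rightarrow> nat \<Rightarrow> bool list list set" where
  "matrices k l = {xss. set xss \<subseteq> {xs. set xs \<subseteq> UNIV \<and> length xs = Suc k} \<and> length xss = Suc l}"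

lemma finite_matrices: "finite (matrices k l)"
  unfolding matrices_def by (intro finite_lists_length_eq) auto

lemma length_mat [simp]: "length (mat k l w) = Suc l"
  by (simp add: mat_def)

lemma mat_nth [simp]: "i \<le> k \<Longrightarrow> j \<le> l \<Longrightarrow> mat k l w ! j ! i = w i j"
  by (simp add: mat_def nth_append del: upt_Suc)

lemma mat_in_matrices: "mat k l w \<in> matrices k l"
  by (auto simp: matrices_def mat_def)

lemma mat_eq_iff:
  assumes "xss \<in> matrices k l"
  shows "mat k l w = xss \<longleftrightarrow> (\<forall>i\<le>k. \<forall>j\<le>l. w i j = xss ! j ! i)"
proof -
  have len: "length xss = Suc l" "\<And>j. j \<le> l \<Longrightarrow> length (xss ! j) = Suc k"
    using assms nth_mem[of _ xss] by (auto simp: matrices_def subset_iff)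
  have "mat k l w = xss \<longleftrightarrow> (\<forall>j<Suc l. mat k l w ! j = xss ! j)"
    by (simp add: list_eq_iff_nth_eq len)
  also have "\<dots> \<longleftrightarrow> (\<forall>j<Suc l. \<forall>i<Suc k. mat k l w ! j ! i = xss ! j ! i)"
    by (intro all_cong) (simp add: list_eq_iff_nth_eq len mat_def del: upt_Suc)
  finally show ?thesis by (auto simp: less_Suc_eq_le)
qed

definition bernoulli_matrix :: "nat \<Rightarrow> nat \<Rightarrow> (nat \<Rightarrow> nat \<Rightarrow> real) \<Rightarrow> bool list list pmf" where
  "bernoulli_matrix k l q = plist (map plist (mat k l (\<lambda>i j. bernoulli_pmf (q i j))))"

lemma set_pmf_bernoulli_matrix: "set_pmf (bernoulli_matrix k l q) \<subseteq> matrices k l"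
proof
  fix xss assume x: "xss \<in> set_pmf (bernoulli_matrix k l q)"
  then have len: "length xss = Suc l"
    unfolding bernoulli_matrix_def by (auto dest: set_pmf_plist_length)
  have "length (xss ! j) = Suc k" if "j \<le> l" for j
    using set_pmf_plist_nth[OF x[unfolded bernoulli_matrix_def], of j] that
    by (auto dest!: set_pmf_plist_length simp: mat_def nth_append simp del: upt_Suc)
  then show "xss \<in> matrices k l"
    using len by (auto simp: matrices_def in_set_conv_nth)
qed

text \<open>The right side is the conditional probability in \<open>bernoulli_env\<close> in the
  form indexed by sites, so \<open>bernoulli_matrix\<close> is the quenched law of the
  weights.\<close>

lemma pmf_bernoulli_matrix:
  assumes "xss \<in> matrices k l" and q: "\<And>i j. q i j \<in> {0..1}"
  shows "pmf (bernoulli_matrix k l q) xss =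
    (\<Prod>z\<in>{..k}\<times>{..l}. if xss ! snd z ! fst z then q (fst z) (snd z) else 1 - q (fst z) (snd z))"
proof -
  have len: "length xss = Suc l" "\<And>j. j \<le> l \<Longrightarrow> length (xss ! j) = Suc k"
    using assms nth_mem[of _ xss] by (auto simp: matrices_def subset_iff)
  have "pmf (bernoulli_matrix k l q) xss =
      (\<Prod>j\<le>l. pmf (plist (mat k l (\<lambda>i j. bernoulli_pmf (q i j)) ! j)) (xss ! j))"
    unfolding bernoulli_matrix_def by (subst pmf_plist) (simp_all add: len lessThan_Suc_atMost)
  also have "\<dots> = (\<Prod>j\<le>l. \<Prod>i\<le>k. pmf (bernoulli_pmf (q i j)) (xss ! j ! i))"
  proof (intro prod.cong refl)
    fix j assume "j \<in> {..l}"
    then have "mat k l (\<lambda>i j. bernoulli_pmf (q i j)) ! j = map (\<lambda>i. bernoulli_pmf (q i j)) [0..<Suc k]"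
      by (simp add: mat_def nth_append del: upt_Suc)
    then show "pmf (plist (mat k l (\<lambda>i j. bernoulli_pmf (q i j)) ! j)) (xss ! j) =
        (\<Prod>i\<le>k. pmf (bernoulli_pmf (q i j)) (xss ! j ! i))"
      using \<open>j \<in> {..l}\<close> by (simp add: pmf_plist len lessThan_Suc_atMost del: upt_Suc)
  qed
  also have "\<dots> = (\<Prod>j\<le>l. \<Prod>i\<le>k. if xss ! j ! i then q i j else 1 - q i j)"
    using q by (intro prod.cong refl) auto
  also have "\<dots> = (\<Prod>i\<le>k. \<Prod>j\<le>l. if xss ! j ! i then q i j else 1 - q i j)"
    by (rule prod.swap)
  finally show ?thesis
    by (simp add: prod.cartesian_product case_prod_beta)
qed

definition T_matrix :: "nat \<Rightarrow> nat \<Rightarrow> bool list list \<Rightarrow> real" where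
  "T_matrix k l xss = T_right (\<lambda>i j. of_bool (xss ! j ! i)) k l"

lemma T_matrix_nonneg: "0 \<le> T_matrix k l xss"
proof -
  have "0 \<le> (\<Sum>i\<le>k. of_bool (xss ! 0 ! i) :: real)" by (intro sum_nonneg) auto
  also have "\<dots> \<le> T_matrix k l xss"
    unfolding T_matrix_def by (rule T_right_ge[where y = "\<lambda>_. 0"]) (simp add: right_path_def)
  finally show ?thesis .
qed

lemma T_matrix_le_total:
  assumes "length Is = Suc k" "length R = Suc l" "\<And>J Xs. (J, Xs) \<in> set R \<Longrightarrow> length Xs = Suc k"
  shows "T_matrix k l (map snd R) \<le> real (total R Is)"
  unfolding T_matrix_def
proof (rule T_right_le)
  fix y assume y: "right_path k l y"
  have "(\<Sum>i<0. of_bool (Is ! i)) + (\<Sum>i=0..<length Is. of_bool (snd (R ! y i) ! i)) \<le> total R Is"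
    using right_path_le[OF y] right_path_mono[OF y] assms
    by (intro path_sum_le_total) (auto simp: less_Suc_eq_le)
  then have "real (\<Sum>i\<le>k. of_bool (snd (R ! y i) ! i)) \<le> real (total R Is)"
    unfolding of_nat_le_iff by (simp add: assms atLeast0LessThan lessThan_Suc_atMost del: sum_of_bool_eq)
  moreover have "(\<Sum>i\<le>k. of_bool (map snd R ! y i ! i)) = real (\<Sum>i\<le>k. of_bool (snd (R ! y i) ! i))"
    unfolding of_nat_sum using right_path_le[OF y] by (intro sum.cong refl) (auto simp: assms less_Suc_eq_le)
  ultimately show "(\<Sum>i\<le>k. of_bool (map snd R ! y i ! i)) \<le> real (total R Is)" by simp
qed

text \<open>The weights are coupled with independent boundary increments; pathwise domination by
  \<open>total\<close> and its exact mean give the bound.\<close>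

lemma nn_integral_T_matrix_le:
  fixes a r :: "nat \<Rightarrow> real" and q :: "nat \<Rightarrow> nat \<Rightarrow> real"
  assumes a: "\<And>i. a i \<in> {0..1}" and r: "\<And>j. 0 \<le> r j \<and> r j < 1" and q: "\<And>i j. q i j \<in> {0..1}"
    and bal: "\<And>i j. r j * a i * (1 - q i j) = q i j * (1 - a i)"
  shows "(\<integral>\<^sup>+xss. ennreal (T_matrix k l xss) \<partial>bernoulli_matrix k l q) \<le>
         ennreal ((\<Sum>i\<le>k. a i) + (\<Sum>j\<le>l. r j / (1 - r j)))"
proof -
  define as where "as = map a [0..<Suc k]"
  define rows where "rows = map (\<lambda>j. (map (\<lambda>i. q i j) [0..<Suc k], r j)) [0..<Suc l]"
  let ?A = "plist (map bernoulli_pmf as)"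
  let ?P = "plist (map (\<lambda>(qs, r). pair_pmf (geometric_pmf (1 - r)) (plist (map bernoulli_pmf qs))) rows)"
  \<comment> \<open>Forgetting the left increments leaves the weights. The extra integral over
    \<open>Is\<close> below costs nothing, its law having mass one.\<close>
  have "bernoulli_matrix k l q = map_pmf (map snd) ?P"
    unfolding map_pmf_plist bernoulli_matrix_def rows_def mat_def
    by (simp add: map_snd_pair_pmf o_def del: upt_Suc)
  then have "(\<integral>\<^sup>+xss. ennreal (T_matrix k l xss) \<partial>bernoulli_matrix k l q) =
      (\<integral>\<^sup>+Is. \<integral>\<^sup>+R. ennreal (T_matrix k l (map snd R)) \<partial>?P \<partial>?A)"
    by simp
  also have "\<dots> \<le> (\<integral>\<^sup>+Is. \<integral>\<^sup>+R. ennreal (real (total R Is)) \<partial>?P \<partial>?A)"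
  proof (intro nn_integral_mono_AE AE_pmfI ennreal_leI T_matrix_le_total)
    fix Is R assume Is: "Is \<in> set_pmf ?A" and R: "R \<in> set_pmf ?P"
    show "length Is = Suc k" using set_pmf_plist_length[OF Is] by (simp add: as_def)
    show len: "length R = Suc l" using set_pmf_plist_length[OF R] by (simp add: rows_def)
    fix J Xs assume "(J, Xs) \<in> set R"
    then obtain j where j: "j < Suc l" "R ! j = (J, Xs)" by (auto simp: in_set_conv_nth len)
    then have "(J, Xs) \<in> set_pmf (pair_pmf (geometric_pmf (1 - r j)) (plist (map bernoulli_pmf (map (\<lambda>i. q i j) [0..<Suc k]))))"
      using set_pmf_plist_nth[OF R, of j] by (simp add: rows_def nth_append del: upt_Suc)
    then show "length Xs = Suc k" by (auto dest!: set_pmf_plist_length)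
  qed
  also have "\<dots> = ennreal (sum_list as + (\<Sum>(qs, r)\<leftarrow>rows. r / (1 - r)))"
  proof (rule nn_integral_total)
    show "b \<in> {0..1}" if "b \<in> set as" for b using that a by (auto simp: as_def)
    show "0 \<le> s \<and> s < 1 \<and> length qs = length as" if "(qs, s) \<in> set rows" for qs s
      using that r by (auto simp: rows_def as_def)
    show "qs ! i \<in> {0..1} \<and> s * as ! i * (1 - qs ! i) = qs ! i * (1 - as ! i)"
      if "(qs, s) \<in> set rows" "i < length as" for qs s i
      using that q bal by (auto simp: rows_def as_def nth_append simp del: upt_Suc)
  qed
  also have "sum_list as = (\<Sum>i\<le>k. a i)"
    unfolding as_def by (simp add: interv_sum_list_conv_sum_set_nat atLeast0LessThan lessThan_Suc_atMost del: upt_Suc)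
  also have "(\<Sum>(qs, r)\<leftarrow>rows. r / (1 - r)) = (\<Sum>j\<le>l. r j / (1 - r j))"
    unfolding rows_def by (simp add: o_def interv_sum_list_conv_sum_set_nat atLeast0LessThan lessThan_Suc_atMost del: upt_Suc)
  finally show ?thesis .
qed

section \<open>Averaging over the environment and passing to the limit\<close>

text \<open>Leaves open which index carries the environment: \<open>q i j\<close> is
  \<open>p j\<close> for \<open>T_right\<close>, and \<open>p i\<close> with transposed weights for
  \<open>T_up\<close>.\<close>

locale bernoulli_field = prob_space M for M :: "'a measure" +
  fixes q :: "nat \<Rightarrow> nat \<Rightarrow> 'a \<Rightarrow> real" and Y :: "nat \<Rightarrow> nat \<Rightarrow> 'a \<Rightarrow> real"
  assumes q_meas [measurable]: "\<And>i j. q i j \<in> borel_measurable M"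
    and q_range: "\<And>i j \<omega>. \<omega> \<in> space M \<Longrightarrow> q i j \<omega> \<in> {0..1}"
    and Y_meas [measurable]: "\<And>i j. Y i j \<in> borel_measurable M"
    and law: "\<And>S (e :: nat \<times> nat \<Rightarrow> bool). finite S \<Longrightarrow>
      measure M {\<omega> \<in> space M. \<forall>z\<in>S. Y (fst z) (snd z) \<omega> = (if e z then 1 else 0)} =
      (\<integral>\<omega>. (\<Prod>z\<in>S. if e z then q (fst z) (snd z) \<omega> else 1 - q (fst z) (snd z) \<omega>) \<partial>M)"
begin

text \<open>At one site the masses of the values 1 and 0 are the means of \<open>q\<close> and
  \<open>1 - q\<close>, which add up to one.\<close>

lemma AE_binary: "AE \<omega> in M. \<forall>i j. Y i j \<omega> \<in> {0, 1}"
proof -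
  have "AE \<omega> in M. Y i j \<omega> \<in> {0, 1}" for i j
  proof -
    have int: "integrable M (q i j)"
      using q_range by (intro integrable_const_bound[where B = 1] AE_I2) auto
    have E1: "{\<omega>\<in>space M. Y i j \<omega> = 1} \<in> events" and E0: "{\<omega>\<in>space M. Y i j \<omega> = 0} \<in> events" by measurable
    have "prob {\<omega>\<in>space M. Y i j \<omega> = 1} = (\<integral>\<omega>. q i j \<omega> \<partial>M)"
      using law[of "{(i, j)}" "\<lambda>_. True"] by simp
    moreover have "prob {\<omega>\<in>space M. Y i j \<omega> = 0} = (\<integral>\<omega>. 1 - q i j \<omega> \<partial>M)"
      using law[of "{(i, j)}" "\<lambda>_. False"] by simp
    moreover have "(\<integral>\<omega>. 1 - q i j \<omega> \<partial>M) = 1 - (\<integral>\<omega>. q i j \<omega> \<partial>M)"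
      using int by (simp add: prob_space)
    ultimately have "prob ({\<omega>\<in>space M. Y i j \<omega> = 1} \<union> {\<omega>\<in>space M. Y i j \<omega> = 0}) = 1"
      by (subst finite_measure_Union[OF E1 E0]) auto
    from AE_prob_1[OF this] show ?thesis by (rule AE_mp) (rule AE_I2, auto)
  qed
  then show ?thesis by (simp add: AE_all_countable)
qed

abbreviation Ymat :: "nat \<Rightarrow> nat \<Rightarrow> 'a \<Rightarrow> bool list list" where
  "Ymat k l \<omega> \<equiv> mat k l (\<lambda>i j. Y i j \<omega> = 1)"

lemma AE_T_right_eq: "AE \<omega> in M. \<forall>k l. T_right (\<lambda>i j. Y i j \<omega>) k l = T_matrix k l (Ymat k l \<omega>)"
  using AE_binary
proof eventually_elim
  case (elim \<omega>)
  then show ?case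
    unfolding T_matrix_def by (intro allI T_right_cong) (auto simp: of_bool_def)
qed

lemma Ymat_event [measurable]: "xss \<in> matrices k l \<Longrightarrow> {\<omega>\<in>space M. Ymat k l \<omega> = xss} \<in> events"
  by (simp add: mat_eq_iff) measurable

lemma Ymat_sum:
  fixes f :: "bool list list \<Rightarrow> real"
  assumes "\<omega> \<in> space M"
  shows "f (Ymat k l \<omega>) = (\<Sum>xss\<in>matrices k l. f xss * indicator {\<omega>\<in>space M. Ymat k l \<omega> = xss} \<omega>)"
proof -
  have "(\<Sum>xss\<in>matrices k l. f xss * indicator {\<omega>\<in>space M. Ymat k l \<omega> = xss} \<omega>) =
      (\<Sum>xss\<in>matrices k l. if Ymat k l \<omega> = xss then f xss else 0)"
    using assms by (intro sum.cong refl) auto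
  then show ?thesis by (simp add: finite_matrices mat_in_matrices)
qed

lemma measurable_Ymat [measurable]: "(\<lambda>\<omega>. f (Ymat k l \<omega>) :: real) \<in> borel_measurable M"
proof -
  have "(\<lambda>\<omega>. \<Sum>xss\<in>matrices k l. f xss * indicator {\<omega>\<in>space M. Ymat k l \<omega> = xss} \<omega> :: real) \<in> borel_measurable M"
    by (intro borel_measurable_sum borel_measurable_times borel_measurable_indicator Ymat_event) auto
  then show ?thesis by (subst measurable_cong[OF Ymat_sum])
qed

lemma emeasure_Ymat:
  assumes xss: "xss \<in> matrices k l"
  shows "emeasure M {\<omega>\<in>space M. Ymat k l \<omega> = xss} =
    (\<integral>\<^sup>+\<omega>. ennreal (pmf (bernoulli_matrix k l (\<lambda>i j. q i j \<omega>)) xss) \<partial>M)"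
proof -
  let ?S = "{..k} \<times> {..l}" and ?e = "\<lambda>z. xss ! snd z ! fst z"
  let ?p = "\<lambda>\<omega>. \<Prod>z\<in>?S. if ?e z then q (fst z) (snd z) \<omega> else 1 - q (fst z) (snd z) \<omega>"
  have range: "?p \<omega> \<in> {0..1}" if "\<omega> \<in> space M" for \<omega>
    using q_range[OF that] by (auto intro!: prod_nonneg prod_le_1)
  have "prob {\<omega>\<in>space M. Ymat k l \<omega> = xss} =
      prob {\<omega> \<in> space M. \<forall>z\<in>?S. Y (fst z) (snd z) \<omega> = (if ?e z then 1 else 0)}"
  \<comment> \<open>\<open>Ymat\<close> reads every value other than 1 as \<open>False\<close>, so
    the two events agree only off the null set where some weight is not 0 or 1.\<close>
  proof (rule measure_eq_AE)
    show "AE \<omega> in M. (\<omega> \<in> {\<omega>\<in>space M. Ymat k l \<omega> = xss}) \<longleftrightarrow>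
        (\<omega> \<in> {\<omega> \<in> space M. \<forall>z\<in>?S. Y (fst z) (snd z) \<omega> = (if ?e z then 1 else 0)})"
      using AE_binary
    proof eventually_elim
      case (elim \<omega>)
      then have "(Y i j \<omega> = 1) = e \<longleftrightarrow> Y i j \<omega> = (if e then 1 else 0)" for i j e
        by (cases e) (use elim in auto)
      then show ?case by (auto simp: mat_eq_iff[OF xss])
    qed
    show "{\<omega> \<in> space M. \<forall>z\<in>?S. Y (fst z) (snd z) \<omega> = (if ?e z then 1 else 0)} \<in> events" by measurable
  qed (rule Ymat_event[OF xss])
  also have "\<dots> = (\<integral>\<omega>. ?p \<omega> \<partial>M)" by (rule law) auto
  finally have "emeasure M {\<omega>\<in>space M. Ymat k l \<omega> = xss} = ennreal (\<integral>\<omega>. ?p \<omega> \<partial>M)"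
    by (simp add: emeasure_eq_measure)
  also have "\<dots> = (\<integral>\<^sup>+\<omega>. ennreal (?p \<omega>) \<partial>M)"
  proof (rule nn_integral_eq_integral[symmetric])
    show "integrable M ?p"
    proof (rule integrable_const_bound[where B = 1])
      show "AE \<omega> in M. norm (?p \<omega>) \<le> 1" using range by (intro AE_I2) auto
    qed measurable
  qed (use range in auto)
  also have "\<dots> = (\<integral>\<^sup>+\<omega>. ennreal (pmf (bernoulli_matrix k l (\<lambda>i j. q i j \<omega>)) xss) \<partial>M)"
    using q_range by (intro nn_integral_cong) (simp add: pmf_bernoulli_matrix[OF xss])
  finally show ?thesis .
qed

text \<open>The annealed expectation is the mean of the quenched ones. Both sides are finite sums
  over tables, matched term by term by \<open>emeasure_Ymat\<close>.\<close>

lemma nn_integral_Ymat: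
  fixes f :: "bool list list \<Rightarrow> real"
  assumes f: "\<And>xss. 0 \<le> f xss"
  shows "(\<integral>\<^sup>+\<omega>. ennreal (f (Ymat k l \<omega>)) \<partial>M) =
    (\<integral>\<^sup>+\<omega>. (\<integral>\<^sup>+xss. ennreal (f xss) \<partial>bernoulli_matrix k l (\<lambda>i j. q i j \<omega>)) \<partial>M)"
proof -
  let ?E = "\<lambda>xss. {\<omega>\<in>space M. Ymat k l \<omega> = xss}"
  let ?B = "\<lambda>\<omega>. bernoulli_matrix k l (\<lambda>i j. q i j \<omega>)"
  have meas: "(\<lambda>\<omega>. ennreal (pmf (?B \<omega>) xss)) \<in> borel_measurable M" if xss: "xss \<in> matrices k l" for xss
  proof -
    have "(\<lambda>\<omega>. ennreal (\<Prod>z\<in>{..k}\<times>{..l}. if xss ! snd z ! fst z then q (fst z) (snd z) \<omega>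
        else 1 - q (fst z) (snd z) \<omega>)) \<in> borel_measurable M" by measurable
    then show ?thesis
      using q_range by (subst measurable_cong) (auto simp: pmf_bernoulli_matrix[OF xss])
  qed
  have "(\<integral>\<^sup>+\<omega>. ennreal (f (Ymat k l \<omega>)) \<partial>M) =
      (\<integral>\<^sup>+\<omega>. (\<Sum>xss\<in>matrices k l. ennreal (f xss) * indicator (?E xss) \<omega>) \<partial>M)"
    using f by (intro nn_integral_cong)
      (auto simp: Ymat_sum[of _ f] ennreal_mult' simp flip: sum_ennreal ennreal_indicator)
  also have "\<dots> = (\<Sum>xss\<in>matrices k l. ennreal (f xss) * emeasure M (?E xss))"
    by (subst nn_integral_sum) (auto intro!: sum.cong nn_integral_cmult_indicator borel_measurable_times Ymat_event)
  also have "\<dots> = (\<Sum>xss\<in>matrices k l. \<integral>\<^sup>+\<omega>. ennreal (f xss) * ennreal (pmf (?B \<omega>) xss) \<partial>M)"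
    by (intro sum.cong refl) (simp only: emeasure_Ymat nn_integral_cmult[OF meas])
  also have "\<dots> = (\<integral>\<^sup>+\<omega>. (\<Sum>xss\<in>matrices k l. ennreal (f xss) * ennreal (pmf (?B \<omega>) xss)) \<partial>M)"
    by (rule nn_integral_sum[symmetric]) (intro borel_measurable_times_ennreal meas borel_measurable_const)
  also have "\<dots> = (\<integral>\<^sup>+\<omega>. (\<integral>\<^sup>+xss. ennreal (f xss) \<partial>?B \<omega>) \<partial>M)"
    using set_pmf_bernoulli_matrix
    by (intro nn_integral_cong nn_integral_measure_pmf_support[symmetric] finite_matrices) auto
  finally show ?thesis .
qed

lemma nn_integral_T_right_le:
  fixes a r :: "nat \<Rightarrow> 'a \<Rightarrow> real"
  assumes "AE \<omega> in M. (\<forall>i. a i \<omega> \<in> {0..1}) \<and> (\<forall>j. 0 \<le> r j \<omega> \<and> r j \<omega> < 1) \<and>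
      (\<forall>i j. r j \<omega> * a i \<omega> * (1 - q i j \<omega>) = q i j \<omega> * (1 - a i \<omega>))"
  shows "(\<integral>\<^sup>+\<omega>. ennreal (T_matrix k l (Ymat k l \<omega>)) \<partial>M) \<le>
    (\<integral>\<^sup>+\<omega>. ennreal ((\<Sum>i\<le>k. a i \<omega>) + (\<Sum>j\<le>l. r j \<omega> / (1 - r j \<omega>))) \<partial>M)"
  unfolding nn_integral_Ymat[of "T_matrix k l", OF T_matrix_nonneg]
proof (rule nn_integral_mono_AE)
  show "AE \<omega> in M. (\<integral>\<^sup>+xss. ennreal (T_matrix k l xss) \<partial>bernoulli_matrix k l (\<lambda>i j. q i j \<omega>)) \<le>
      ennreal ((\<Sum>i\<le>k. a i \<omega>) + (\<Sum>j\<le>l. r j \<omega> / (1 - r j \<omega>)))"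
    using assms AE_space
  proof eventually_elim
    case (elim \<omega>)
    then show ?case using q_range by (intro nn_integral_T_matrix_le) auto
  qed
qed

text \<open>Fatou's lemma for the normalised maxima: the almost sure limit is constant, so its
  integral is \<open>Psi\<close> itself.\<close>

lemma limit_le:
  fixes x y A B Psi :: real
  assumes A: "0 \<le> A" and B: "0 \<le> B" and x: "0 < x" and y: "0 < y"
    and bound: "\<And>k l. (\<integral>\<^sup>+\<omega>. ennreal (T_matrix k l (Ymat k l \<omega>)) \<partial>M) \<le> ennreal (real (Suc k) * A + real (Suc l) * B)"
    and lim: "AE \<omega> in M. (\<lambda>n. T_right (\<lambda>i j. Y i j \<omega>) (nat \<lfloor>real n * x\<rfloor>) (nat \<lfloor>real n * y\<rfloor>) / real n) \<longlonglongrightarrow> Psi"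
  shows "Psi \<le> A * x + B * y"
proof -
  define K where "K n = nat \<lfloor>real n * x\<rfloor>" for n
  define L where "L n = nat \<lfloor>real n * y\<rfloor>" for n
  define g where "g n \<omega> = T_matrix (K n) (L n) (Ymat (K n) (L n) \<omega>)" for n \<omega>
  have g_meas [measurable]: "g n \<in> borel_measurable M" for n
    unfolding g_def by measurable
  have "AE \<omega> in M. liminf (\<lambda>n. ennreal (g n \<omega> / real n)) = ennreal Psi"
    using lim AE_T_right_eq
  proof eventually_elim
    case (elim \<omega>)
    then have "(\<lambda>n. g n \<omega> / real n) \<longlonglongrightarrow> Psi" by (simp add: g_def K_def L_def)
    then have "(\<lambda>n. ennreal (g n \<omega> / real n)) \<longlonglongrightarrow> ennreal Psi" by (rule tendsto_ennrealI)
    then show ?case by (intro lim_imp_Liminf) auto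
  qed
  then have "(\<integral>\<^sup>+\<omega>. liminf (\<lambda>n. ennreal (g n \<omega> / real n)) \<partial>M) = (\<integral>\<^sup>+\<omega>. ennreal Psi \<partial>M)"
    by (rule nn_integral_cong_AE)
  then have "ennreal Psi = (\<integral>\<^sup>+\<omega>. liminf (\<lambda>n. ennreal (g n \<omega> / real n)) \<partial>M)"
    by (simp add: emeasure_space_1)
  also have "\<dots> \<le> liminf (\<lambda>n. \<integral>\<^sup>+\<omega>. ennreal (g n \<omega> / real n) \<partial>M)"
    by (rule nn_integral_liminf) measurable
  also have "\<dots> \<le> liminf (\<lambda>n. ennreal ((real (Suc (K n)) * A + real (Suc (L n)) * B) / real n))"
  proof (intro Liminf_mono always_eventually allI)
    fix n
    have "(\<integral>\<^sup>+\<omega>. ennreal (g n \<omega> / real n) \<partial>M) = (\<integral>\<^sup>+\<omega>. ennreal (1 / real n) * ennreal (g n \<omega>) \<partial>M)"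
      by (intro nn_integral_cong) (simp add: ennreal_mult'[symmetric])
    also have "\<dots> = ennreal (1 / real n) * (\<integral>\<^sup>+\<omega>. ennreal (g n \<omega>) \<partial>M)"
      by (rule nn_integral_cmult) measurable
    also have "\<dots> \<le> ennreal (1 / real n) * ennreal (real (Suc (K n)) * A + real (Suc (L n)) * B)"
      unfolding g_def by (intro mult_left_mono bound) auto
    also have "\<dots> = ennreal ((real (Suc (K n)) * A + real (Suc (L n)) * B) / real n)"
      by (simp add: ennreal_mult'[symmetric])
    finally show "(\<integral>\<^sup>+\<omega>. ennreal (g n \<omega> / real n) \<partial>M) \<le> \<dots>" .
  qed
  also have "\<dots> = ennreal (A * x + B * y)"
  proof (intro lim_imp_Liminf tendsto_ennrealI)
    \<comment> \<open>Indices start at 0, so there are floor plus one columns or rows, a number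
      between \<open>n * c\<close> and \<open>n * c + 1\<close>.\<close>
    have fl: "(\<lambda>n. real (Suc (nat \<lfloor>real n * c\<rfloor>)) / real n) \<longlonglongrightarrow> c" if "0 < c" for c :: real
    proof (rule tendsto_sandwich)
      show "\<forall>\<^sub>F n in sequentially. c \<le> real (Suc (nat \<lfloor>real n * c\<rfloor>)) / real n"
      proof (rule eventually_mono[OF eventually_gt_at_top[of 0]])
        fix n :: nat assume n: "0 < n"
        have "real n * c \<le> real (Suc (nat \<lfloor>real n * c\<rfloor>))"
          by linarith
        then show "c \<le> real (Suc (nat \<lfloor>real n * c\<rfloor>)) / real n"
          using n by (simp add: field_simps)
      qed
      show "\<forall>\<^sub>F n in sequentially. real (Suc (nat \<lfloor>real n * c\<rfloor>)) / real n \<le> c + 1 / real n"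
      proof (rule eventually_mono[OF eventually_gt_at_top[of 0]])
        fix n :: nat assume n: "0 < n"
        have "0 \<le> real n * c" using that by simp
        then have "real (Suc (nat \<lfloor>real n * c\<rfloor>)) \<le> real n * c + 1"
          by linarith
        then show "real (Suc (nat \<lfloor>real n * c\<rfloor>)) / real n \<le> c + 1 / real n"
          using n by (simp add: field_simps)
      qed
      show "(\<lambda>n. c + 1 / real n) \<longlonglongrightarrow> c"
        using tendsto_add[OF tendsto_const lim_1_over_n, of c] by simp
    qed simp
    have "(\<lambda>n. A * (real (Suc (K n)) / real n) + B * (real (Suc (L n)) / real n)) \<longlonglongrightarrow> A * x + B * y"
      unfolding K_def L_def by (intro tendsto_intros fl x y)
    then show "(\<lambda>n. (real (Suc (K n)) * A + real (Suc (L n)) * B) / real n) \<longlonglongrightarrow> A * x + B * y"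
      by (simp add: add_divide_distrib mult.commute del: of_nat_Suc)
  qed simp
  \<comment> \<open>\<open>ennreal\<close> truncates a negative \<open>Psi\<close> to 0; this is
    harmless because the right side is non-negative.\<close>
  finally show ?thesis
    using A B x y by (subst (asm) ennreal_le_iff) auto
qed

text \<open>\<open>a\<close> and \<open>r\<close> may depend on the environment. The majorants
  \<open>A'\<close> and \<open>B'\<close> are chosen later so that their means can be bounded
  through those of \<open>p\<close> and its square.\<close>

lemma limit_le_of_balance:
  fixes a r A' B' :: "nat \<Rightarrow> 'a \<Rightarrow> real" and x y A B Psi :: real
  assumes bal: "AE \<omega> in M. (\<forall>i. a i \<omega> \<in> {0..1}) \<and> (\<forall>j. 0 \<le> r j \<omega> \<and> r j \<omega> < 1) \<and>
      (\<forall>i j. r j \<omega> * a i \<omega> * (1 - q i j \<omega>) = q i j \<omega> * (1 - a i \<omega>))"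
    and le: "AE \<omega> in M. (\<forall>i. a i \<omega> \<le> A' i \<omega>) \<and> (\<forall>j. r j \<omega> / (1 - r j \<omega>) \<le> B' j \<omega>)"
    and intA: "\<And>i. integrable M (A' i)" and A: "\<And>i. (\<integral>\<omega>. A' i \<omega> \<partial>M) \<le> A"
    and intB: "\<And>j. integrable M (B' j)" and B: "\<And>j. (\<integral>\<omega>. B' j \<omega> \<partial>M) \<le> B"
    and x: "0 < x" and y: "0 < y"
    and lim: "AE \<omega> in M. (\<lambda>n. T_right (\<lambda>i j. Y i j \<omega>) (nat \<lfloor>real n * x\<rfloor>) (nat \<lfloor>real n * y\<rfloor>) / real n) \<longlonglongrightarrow> Psi"
  shows "Psi \<le> A * x + B * y"
proof (rule limit_le[OF _ _ x y _ lim])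
  have nonneg: "AE \<omega> in M. (\<forall>i. 0 \<le> A' i \<omega>) \<and> (\<forall>j. 0 \<le> B' j \<omega>)"
    using bal le
  proof eventually_elim
    case (elim \<omega>)
    have "0 \<le> A' i \<omega>" for i using elim by (meson atLeastAtMost_iff order_trans)
    moreover have "0 \<le> B' j \<omega>" for j
      using elim by (meson diff_ge_0_iff_ge divide_nonneg_nonneg less_imp_le order_trans)
    ultimately show ?case by blast
  qed
  have "0 \<le> (\<integral>\<omega>. A' 0 \<omega> \<partial>M)" using nonneg by (intro integral_nonneg_AE) auto
  then show "0 \<le> A" using A[of 0] by simp
  have "0 \<le> (\<integral>\<omega>. B' 0 \<omega> \<partial>M)" using nonneg by (intro integral_nonneg_AE) auto
  then show "0 \<le> B" using B[of 0] by simp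
  fix k l
  have "(\<integral>\<^sup>+\<omega>. ennreal (T_matrix k l (Ymat k l \<omega>)) \<partial>M) \<le>
      (\<integral>\<^sup>+\<omega>. ennreal ((\<Sum>i\<le>k. a i \<omega>) + (\<Sum>j\<le>l. r j \<omega> / (1 - r j \<omega>))) \<partial>M)"
    by (rule nn_integral_T_right_le[OF bal])
  also have "\<dots> \<le> (\<integral>\<^sup>+\<omega>. ennreal ((\<Sum>i\<le>k. A' i \<omega>) + (\<Sum>j\<le>l. B' j \<omega>)) \<partial>M)"
  proof (rule nn_integral_mono_AE)
    show "AE \<omega> in M. ennreal ((\<Sum>i\<le>k. a i \<omega>) + (\<Sum>j\<le>l. r j \<omega> / (1 - r j \<omega>))) \<le>
        ennreal ((\<Sum>i\<le>k. A' i \<omega>) + (\<Sum>j\<le>l. B' j \<omega>))"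
      using le by eventually_elim (intro ennreal_leI add_mono sum_mono; simp)
  qed
  also have "\<dots> = ennreal (\<integral>\<omega>. (\<Sum>i\<le>k. A' i \<omega>) + (\<Sum>j\<le>l. B' j \<omega>) \<partial>M)"
  proof (rule nn_integral_eq_integral)
    show "AE \<omega> in M. 0 \<le> (\<Sum>i\<le>k. A' i \<omega>) + (\<Sum>j\<le>l. B' j \<omega>)"
      using nonneg by eventually_elim (intro add_nonneg_nonneg sum_nonneg; simp)
  qed (use intA intB in auto)
  also have "(\<integral>\<omega>. (\<Sum>i\<le>k. A' i \<omega>) + (\<Sum>j\<le>l. B' j \<omega>) \<partial>M) =
      (\<Sum>i\<le>k. \<integral>\<omega>. A' i \<omega> \<partial>M) + (\<Sum>j\<le>l. \<integral>\<omega>. B' j \<omega> \<partial>M)"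
    using intA intB by simp
  also have "ennreal \<dots> \<le> ennreal ((\<Sum>i\<le>k. A) + (\<Sum>j\<le>l. B))"
    by (intro ennreal_leI add_mono sum_mono A B)
  finally show "(\<integral>\<^sup>+\<omega>. ennreal (T_matrix k l (Ymat k l \<omega>)) \<partial>M) \<le> ennreal (real (Suc k) * A + real (Suc l) * B)"
    by simp
qed

end

section \<open>Bounds with a free parameter in the i.i.d. environment\<close>

context
  fixes M :: "'a measure" and p :: "nat \<Rightarrow> 'a \<Rightarrow> real" and X :: "nat \<Rightarrow> nat \<Rightarrow> 'a \<Rightarrow> real"
  assumes env: "bernoulli_env M p X"
begin

interpretation prob_space M
  using env by (simp add: bernoulli_env_def)

lemma env_p_measurable [measurable]: "p j \<in> borel_measurable M"
  using env by (auto simp: bernoulli_env_def indep_vars_def)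

lemma env_p_range: "\<omega> \<in> space M \<Longrightarrow> p j \<omega> \<in> {0..1}"
  using env by (auto simp: bernoulli_env_def)

lemma env_p_distr: "distr M borel (p j) = distr M borel (p 0)"
  using env unfolding bernoulli_env_def by blast

lemma env_law:
  fixes e :: "nat \<times> nat \<Rightarrow> bool"
  assumes "finite S"
  shows "measure M {\<omega> \<in> space M. \<forall>z\<in>S. X (fst z) (snd z) \<omega> = (if e z then 1 else 0)} =
      (\<integral>\<omega>. (\<Prod>z\<in>S. if e z then p (snd z) \<omega> else 1 - p (snd z) \<omega>) \<partial>M)"
proof -
  have "UNIV \<in> sets (Pi\<^sub>M UNIV (\<lambda>_. borel) :: (nat \<Rightarrow> real) measure)"
    using sets.top[of "Pi\<^sub>M UNIV (\<lambda>_. borel) :: (nat \<Rightarrow> real) measure"] by (simp add: space_PiM)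
  with env assms have "measure M {\<omega> \<in> space M. (\<lambda>j. p j \<omega>) \<in> UNIV \<and>
            (\<forall>z\<in>S. X (fst z) (snd z) \<omega> = (if e z then 1 else 0))}
        = (\<integral>\<omega>. indicator UNIV (\<lambda>j. p j \<omega>) *
              (\<Prod>z\<in>S. if e z then p (snd z) \<omega> else 1 - p (snd z) \<omega>) \<partial>M)"
    unfolding bernoulli_env_def by blast
  then show ?thesis by simp
qed

lemma env_field_right: "bernoulli_field M (\<lambda>i j. p j) X"
proof unfold_locales
  show "X i j \<in> borel_measurable M" for i j using env by (auto simp: bernoulli_env_def)
qed (use env_p_range env_law in auto)

lemma env_field_up: "bernoulli_field M (\<lambda>i j. p i) (\<lambda>i j. X j i)"
proof unfold_locales
  show "X j i \<in> borel_measurable M" for i j using env by (auto simp: bernoulli_env_def)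
  fix S :: "(nat \<times> nat) set" and e :: "nat \<times> nat \<Rightarrow> bool" assume "finite S"
  \<comment> \<open>The law of the transposed weights on \<open>S\<close> is that of the original
    ones on the reflected set.\<close>
  moreover have "inj_on prod.swap S" by simp
  ultimately show "prob {\<omega> \<in> space M. \<forall>z\<in>S. X (snd z) (fst z) \<omega> = (if e z then 1 else 0)} =
      (\<integral>\<omega>. (\<Prod>z\<in>S. if e z then p (fst z) \<omega> else 1 - p (fst z) \<omega>) \<partial>M)"
    using env_law[of "prod.swap ` S" "e \<circ> prod.swap"]
    by (simp add: prod.reindex cong: if_cong)
qed (use env_p_range in auto)

lemma env_p_integrable: "integrable M (p j)"
  using env_p_range by (intro integrable_const_bound[where B = 1] AE_I2) auto

lemma env_p2_integrable: "integrable M (\<lambda>\<omega>. (p j \<omega>)\<^sup>2)"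
  using env_p_range by (intro integrable_const_bound[where B = 1] AE_I2) (auto simp: power_le_one)

lemma env_p_expectation: "(\<integral>\<omega>. p j \<omega> \<partial>M) = (\<integral>\<omega>. p 0 \<omega> \<partial>M)"
proof -
  have "(\<integral>\<omega>. p i \<omega> \<partial>M) = (\<integral>t. t \<partial>distr M borel (p i))" for i
    by (subst integral_distr) auto
  then show ?thesis using env_p_distr by metis
qed

text \<open>The essential supremum lies in [0,1], so \<open>real_of_ereal\<close> does not fall back
  to its default value 0. Equality of laws carries the bound from \<open>p 0\<close> to all
  \<open>p j\<close>.\<close>

lemma env_p_le_esssup:
  assumes b: "b = real_of_ereal (esssup M (\<lambda>\<omega>. ereal (p 0 \<omega>)))"
  shows "b \<le> 1" and "AE \<omega> in M. \<forall>j. p j \<omega> \<le> b"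
proof -
  let ?s = "esssup M (\<lambda>\<omega>. ereal (p 0 \<omega>))"
  have s1: "?s \<le> 1" using env_p_range by (intro esssup_I AE_I2) auto
  have "AE \<omega> in M. 0 \<le> ?s"
    using esssup_AE[of "\<lambda>\<omega>. ereal (p 0 \<omega>)" M] AE_space
  proof eventually_elim
    case (elim \<omega>)
    have "0 \<le> ereal (p 0 \<omega>)" using env_p_range[OF elim(2)] by auto
    also note elim(1)
    finally show ?case .
  qed
  then have s0: "0 \<le> ?s" by simp
  have sb: "?s = ereal b" using s0 s1 unfolding b by (cases ?s) auto
  show "b \<le> 1" using s1 by (simp add: sb)
  have "AE \<omega> in M. p 0 \<omega> \<le> b"
    using esssup_AE[of "\<lambda>\<omega>. ereal (p 0 \<omega>)" M] by (simp add: sb)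
  then have "AE t in distr M borel (p 0). t \<le> b"
    by (subst AE_distr_iff) auto
  then have "AE t in distr M borel (p j). t \<le> b" for j
    by (subst env_p_distr)
  then have "AE \<omega> in M. p j \<omega> \<le> b" for j
    by (subst (asm) AE_distr_iff) auto
  then show "AE \<omega> in M. \<forall>j. p j \<omega> \<le> b" by (simp add: AE_all_countable)
qed

text \<open>The choice \<open>a = 1\<close> gives the trivial bound \<open>Psi \<le> x\<close>, also when \<open>b = 1\<close> since then
  \<open>0 / 0 = 0\<close>.\<close>
lemma env_Psi_right_le:
  assumes b: "b = real_of_ereal (esssup M (\<lambda>\<omega>. ereal (p 0 \<omega>)))"
    and a: "b < a \<and> a < 1 \<or> a = 1"
    and x: "0 < x" and y: "0 < y"
    and lim: "AE \<omega> in M. (\<lambda>n. T_right (\<lambda>i j. X i j \<omega>) (nat \<lfloor>real n * x\<rfloor>) (nat \<lfloor>real n * y\<rfloor>) / real n) \<longlonglongrightarrow> Psi"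
  shows "Psi \<le> a * x + (\<integral>\<omega>. p 0 \<omega> \<partial>M) * (1 - a) / (a - b) * y"
proof -
  interpret bernoulli_field M "\<lambda>i j. p j" X by (rule env_field_right)
  \<comment> \<open>Solves the balance equation for constant \<open>a\<close>. When
    \<open>a < 1\<close>, \<open>p j \<omega> \<le> b < a\<close> yields
    \<open>r j \<omega> < 1\<close>; when \<open>a = 1\<close>, \<open>r\<close> vanishes.\<close>
  define r where "r j \<omega> = p j \<omega> * (1 - a) / (a * (1 - p j \<omega>))" for j \<omega>
  have facts: "0 \<le> a \<and> a \<le> 1 \<and> 0 \<le> r j \<omega> \<and> r j \<omega> < 1 \<and> r j \<omega> * a * (1 - p j \<omega>) = p j \<omega> * (1 - a) \<and>
      r j \<omega> / (1 - r j \<omega>) \<le> p j \<omega> * ((1 - a) / (a - b))"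
    if "0 \<le> p j \<omega>" "p j \<omega> \<le> b" for j \<omega>
  proof (cases "a = 1")
    case False
    with a have ab: "b < a" "a < 1" by auto
    with that have pa: "p j \<omega> < a" "0 < a" by auto
    have "p j \<omega> * (1 - a) < a * (1 - p j \<omega>)" using pa by (simp add: algebra_simps)
    then have r1: "r j \<omega> < 1" using pa ab by (simp add: r_def)
    have "1 - r j \<omega> = (a - p j \<omega>) / (a * (1 - p j \<omega>))"
      using pa ab by (simp add: r_def field_simps)
    then have "r j \<omega> / (1 - r j \<omega>) = p j \<omega> * (1 - a) / (a - p j \<omega>)"
      using pa ab by (simp add: r_def)
    \<comment> \<open>With \<open>a - b\<close> in the denominator the bound is linear in
      \<open>p\<close>, so its mean involves only the mean of \<open>p\<close>.\<close>
    also have "\<dots> \<le> p j \<omega> * (1 - a) / (a - b)"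
      using that ab pa by (intro divide_left_mono) auto
    finally show ?thesis
      using r1 pa ab that by (auto simp: r_def)
  qed (auto simp: r_def)
  have pb: "AE \<omega> in M. \<forall>j. 0 \<le> p j \<omega> \<and> p j \<omega> \<le> b"
    using env_p_le_esssup(2)[OF b] AE_space by eventually_elim (use env_p_range in auto)
  have "Psi \<le> a * x + ((\<integral>\<omega>. p 0 \<omega> \<partial>M) * ((1 - a) / (a - b))) * y"
  proof (rule limit_le_of_balance[where a = "\<lambda>_ _. a" and r = r and A' = "\<lambda>_ _. a"
        and B' = "\<lambda>j \<omega>. p j \<omega> * ((1 - a) / (a - b))"])
    show "AE \<omega> in M. (\<forall>i::nat. a \<in> {0..1}) \<and> (\<forall>j. 0 \<le> r j \<omega> \<and> r j \<omega> < 1) \<and>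
        (\<forall>(i::nat) j. r j \<omega> * a * (1 - p j \<omega>) = p j \<omega> * (1 - a))"
      using pb by eventually_elim (use facts in auto)
    show "AE \<omega> in M. (\<forall>i::nat. a \<le> a) \<and> (\<forall>j. r j \<omega> / (1 - r j \<omega>) \<le> p j \<omega> * ((1 - a) / (a - b)))"
      using pb by eventually_elim (use facts in auto)
    show "integrable M (\<lambda>\<omega>. p j \<omega> * ((1 - a) / (a - b)))" for j
      using env_p_integrable[of j] by (rule integrable_mult_left)
    show "(\<integral>\<omega>. p j \<omega> * ((1 - a) / (a - b)) \<partial>M) \<le> (\<integral>\<omega>. p 0 \<omega> \<partial>M) * ((1 - a) / (a - b))" for j
      using env_p_expectation[of j] by simp
  qed (use x y lim in \<open>simp_all add: prob_space\<close>)
  then show ?thesis by simp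
qed

text \<open>\<open>s\<close> is the mean left increment of the transposed model, that is
  \<open>r / (1 - r)\<close> for the constant \<open>r = s / (1 + s)\<close>; it multiplies
  \<open>x\<close> because the roles of the axes are exchanged.\<close>

lemma env_Psi_up_le:
  assumes pbar: "pbar = (\<integral>\<omega>. p 0 \<omega> \<partial>M)" and s: "0 < s" and x: "0 < x" and y: "0 < y"
    and lim: "AE \<omega> in M. (\<lambda>n. T_up (\<lambda>i j. X i j \<omega>) (nat \<lfloor>real n * x\<rfloor>) (nat \<lfloor>real n * y\<rfloor>) / real n) \<longlonglongrightarrow> Psi"
  shows "Psi \<le> (pbar + pbar * (1 - pbar) / s) * y + s * x"
proof -
  interpret bernoulli_field M "\<lambda>i j. p i" "\<lambda>i j. X j i" by (rule env_field_up)
  \<comment> \<open>Solves the balance equation for this constant \<open>r\<close>.\<close>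
  define a where "a i \<omega> = p i \<omega> * (1 + s) / (p i \<omega> + s)" for i \<omega>
  have facts: "0 \<le> a i \<omega> \<and> a i \<omega> \<le> 1 \<and> s / (1 + s) * a i \<omega> * (1 - p i \<omega>) = p i \<omega> * (1 - a i \<omega>) \<and>
      a i \<omega> \<le> p i \<omega> + (p i \<omega> - (p i \<omega>)\<^sup>2) / s"
    if "\<omega> \<in> space M" for i \<omega>
  proof -
    have p: "0 \<le> p i \<omega>" "p i \<omega> \<le> 1" using env_p_range[OF that] by auto
    have ps: "0 < p i \<omega> + s" using p s by simp
    have "s / (1 + s) * a i \<omega> = p i \<omega> * s / (p i \<omega> + s)"
      using s by (simp add: a_def)
    moreover have "1 - a i \<omega> = s * (1 - p i \<omega>) / (p i \<omega> + s)"
      using ps by (simp add: a_def field_simps)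
    ultimately have bal: "s / (1 + s) * a i \<omega> * (1 - p i \<omega>) = p i \<omega> * (1 - a i \<omega>)"
      by simp
    have "a i \<omega> = p i \<omega> + (p i \<omega> - (p i \<omega>)\<^sup>2) / (p i \<omega> + s)"
      using ps by (simp add: a_def field_simps power2_eq_square)
    \<comment> \<open>Replacing \<open>p + s\<close> by \<open>s\<close> leaves a quadratic
      polynomial in \<open>p\<close>, whose mean is bounded below through the non-negative
      variance.\<close>
    also have "\<dots> \<le> p i \<omega> + (p i \<omega> - (p i \<omega>)\<^sup>2) / s"
      using p s by (intro add_left_mono divide_left_mono) (auto simp: power2_eq_square mult_left_le)
    finally have "a i \<omega> \<le> p i \<omega> + (p i \<omega> - (p i \<omega>)\<^sup>2) / s" .
    moreover have "0 \<le> a i \<omega>" "a i \<omega> \<le> 1"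
      using p s ps by (auto simp: a_def algebra_simps mult_left_le)
    ultimately show ?thesis using bal by blast
  qed
  show ?thesis
  proof (rule limit_le_of_balance[where a = a and r = "\<lambda>_ _. s / (1 + s)" and B' = "\<lambda>_ _. s"
        and A' = "\<lambda>i \<omega>. p i \<omega> + (p i \<omega> - (p i \<omega>)\<^sup>2) / s"])
    show "AE \<omega> in M. (\<forall>i. a i \<omega> \<in> {0..1}) \<and> (\<forall>j::nat. 0 \<le> s / (1 + s) \<and> s / (1 + s) < 1) \<and>
        (\<forall>i (j::nat). s / (1 + s) * a i \<omega> * (1 - p i \<omega>) = p i \<omega> * (1 - a i \<omega>))"
      using AE_space by eventually_elim (use facts s in auto)
    have odds: "s / (1 + s) / (1 - s / (1 + s)) = s" using s by (simp add: field_simps)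
    show "AE \<omega> in M. (\<forall>i. a i \<omega> \<le> p i \<omega> + (p i \<omega> - (p i \<omega>)\<^sup>2) / s) \<and>
        (\<forall>j::nat. s / (1 + s) / (1 - s / (1 + s)) \<le> s)"
      unfolding odds using AE_space by eventually_elim (use facts in auto)
    show "integrable M (\<lambda>\<omega>. p i \<omega> + (p i \<omega> - (p i \<omega>)\<^sup>2) / s)" for i
      using env_p_integrable[of i] env_p2_integrable[of i] by auto
    show "(\<integral>\<omega>. p i \<omega> + (p i \<omega> - (p i \<omega>)\<^sup>2) / s \<partial>M) \<le> pbar + pbar * (1 - pbar) / s" for i
    proof -
      have m: "(\<integral>\<omega>. p i \<omega> \<partial>M) = pbar" using env_p_expectation[of i] pbar by simp
      have "variance (p i) = (\<integral>\<omega>. (p i \<omega>)\<^sup>2 \<partial>M) - pbar\<^sup>2"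
        using variance_eq[OF env_p_integrable[of i] env_p2_integrable[of i]] m by simp
      moreover have "0 \<le> variance (p i)" by (rule variance_positive)
      ultimately have "pbar\<^sup>2 \<le> (\<integral>\<omega>. (p i \<omega>)\<^sup>2 \<partial>M)" by simp
      then have "(pbar - (\<integral>\<omega>. (p i \<omega>)\<^sup>2 \<partial>M)) / s \<le> pbar * (1 - pbar) / s"
        using s by (intro divide_right_mono) (auto simp: power2_eq_square algebra_simps)
      then show ?thesis
        using env_p_integrable[of i] env_p2_integrable[of i] m by simp
    qed
    show "AE \<omega> in M. (\<lambda>n. T_right (\<lambda>i j. X j i \<omega>) (nat \<lfloor>real n * y\<rfloor>) (nat \<lfloor>real n * x\<rfloor>) / real n) \<longlonglongrightarrow> Psi"
      using lim by (simp add: T_up_eq_T_right)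
  qed (use x y in \<open>simp_all add: prob_space\<close>)
qed

lemma env_Psi_le_sum:
  assumes lim_right: "AE \<omega> in M. (\<lambda>n. T_right (\<lambda>i j. X i j \<omega>) (K n) (L n) / real n) \<longlonglongrightarrow> Psi_right"
    and lim_up: "AE \<omega> in M. (\<lambda>n. T_up (\<lambda>i j. X i j \<omega>) (K n) (L n) / real n) \<longlonglongrightarrow> Psi_up"
    and lim_nn: "AE \<omega> in M. (\<lambda>n. T_nn (\<lambda>i j. X i j \<omega>) (K n) (L n) / real n) \<longlonglongrightarrow> Psi"
  shows "Psi \<le> Psi_right + Psi_up"
proof -
  interpret bernoulli_field M "\<lambda>i j. p j" X by (rule env_field_right)
  have "AE \<omega> in M. Psi \<le> Psi_right + Psi_up"
    using lim_right lim_up lim_nn AE_binary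
  proof eventually_elim
    case (elim \<omega>)
    let ?w = "\<lambda>i j. X i j \<omega>"
    have "?w 0 0 \<in> {0, 1}" using elim(4) by blast
    then have "0 \<le> ?w 0 0" by auto
    then have "T_nn ?w (K n) (L n) / real n \<le> T_right ?w (K n) (L n) / real n + T_up ?w (K n) (L n) / real n" for n
      using T_nn_le[of ?w "K n" "L n"] by (simp add: add_divide_distrib[symmetric] divide_right_mono)
    then show ?case
      by (intro LIMSEQ_le[OF elim(3) tendsto_add[OF elim(1,2)]]) auto
  qed
  then show ?thesis by simp
qed

end

section \<open>Optimisation over the free parameter and conclusion\<close>

text \<open>The minimiser of \<open>s * x + c / s * y\<close> is \<open>sqrt (c * y / x)\<close>,
  where both terms equal \<open>sqrt (c * x * y)\<close>. If it is at least \<open>u\<close>, the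
  bound \<open>large\<close> is already good enough; if it is 0, then \<open>c = 0\<close> and
  \<open>s\<close> tends to 0.\<close>

lemma le_two_sqrt_of_slope_bounds:
  fixes P c d x y u :: real
  assumes "0 \<le> c" "0 < x" "0 < y" "0 < u"
    and small: "\<And>s. 0 < s \<Longrightarrow> s < u \<Longrightarrow> P \<le> d + s * x + c / s * y"
    and large: "P \<le> d + u * x"
  shows "P \<le> d + 2 * sqrt (c * x * y)"
proof -
  define s where "s = sqrt (c * y / x)"
  have s0: "0 \<le> s" using assms by (simp add: s_def)
  have sx: "s * x = sqrt (c * x * y)"
  proof -
    have "s * x = sqrt (c * y / x) * sqrt (x\<^sup>2)" using assms(2) by (simp add: s_def)
    also have "\<dots> = sqrt (c * y / x * x\<^sup>2)" by (rule real_sqrt_mult[symmetric])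
    also have "c * y / x * x\<^sup>2 = c * x * y" using assms(2) by (simp add: power2_eq_square)
    finally show ?thesis .
  qed
  consider "u \<le> s" | "0 < s" "s < u" | "s = 0" using s0 by linarith
  then show ?thesis
  proof cases
    case 1
    then have "u * x \<le> s * x" using assms by (intro mult_right_mono) auto
    moreover have "0 \<le> sqrt (c * x * y)" using assms by simp
    ultimately show ?thesis using large sx by linarith
  next
    case 2
    have "s * s = c * y / x" using assms by (simp add: s_def)
    then have "c / s * y = s * x" using 2 assms by (simp add: field_simps)
    then show ?thesis using small[OF 2] sx by simp
  next
    case 3
    then have c: "c = 0" using assms by (simp add: s_def)
    have "P \<le> d"
    proof (rule field_le_epsilon)
      fix e :: real assume e: "0 < e"
      define t where "t = min (u / 2) (e / x)"
      have t: "0 < t" "t < u" "t \<le> e / x" using assms e by (auto simp: t_def)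
      then have "t * x \<le> e" using assms by (simp add: field_simps)
      then show "P \<le> d + e" using small[OF t(1,2)] c by simp
    qed
    then show ?thesis using c by simp
  qed
qed

theorem theorem3p2:
  fixes M :: "'a measure" and p :: "nat \<Rightarrow> 'a \<Rightarrow> real"
    and X :: "nat \<Rightarrow> nat \<Rightarrow> 'a \<Rightarrow> real"
    and x y b pbar Psi_right Psi_up Psi :: real
  assumes env: "bernoulli_env M p X"
    and b_def: "b = real_of_ereal (esssup M (\<lambda>\<omega>. ereal (p 0 \<omega>)))"
    and pbar_def: "pbar = (\<integral>\<omega>. p 0 \<omega> \<partial>M)"
    and x_pos: "0 < x" and y_pos: "0 < y"
    and lim_right: "AE \<omega> in M. (\<lambda>n. T_right (\<lambda>i j. X i j \<omega>) (nat \<lfloor>real n * x\<rfloor>) (nat \<lfloor>real n * y\<rfloor>) / real n)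
                        \<longlonglongrightarrow> Psi_right"
    and lim_up: "AE \<omega> in M. (\<lambda>n. T_up (\<lambda>i j. X i j \<omega>) (nat \<lfloor>real n * x\<rfloor>) (nat \<lfloor>real n * y\<rfloor>) / real n)
                        \<longlonglongrightarrow> Psi_up"
    and lim_nn: "AE \<omega> in M. (\<lambda>n. T_nn (\<lambda>i j. X i j \<omega>) (nat \<lfloor>real n * x\<rfloor>) (nat \<lfloor>real n * y\<rfloor>) / real n)
                        \<longlonglongrightarrow> Psi"
  shows "Psi_right \<le> b * x + 2 * sqrt (pbar * (1 - b) * x * y) \<and>
         Psi_up \<le> pbar * y + 2 * sqrt (pbar * (1 - pbar) * x * y) \<and>
         Psi \<le> pbar * y + 4 * sqrt (pbar * (1 - pbar) * x * y) + b * x"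
proof -
  interpret prob_space M using env by (simp add: bernoulli_env_def)
  have b1: "b \<le> 1" and pb: "AE \<omega> in M. \<forall>j. p j \<omega> \<le> b"
    using env_p_le_esssup[OF env b_def] by auto
  have pbar0: "0 \<le> pbar"
    unfolding pbar_def using env_p_range[OF env] by (intro integral_nonneg_AE AE_I2) auto
  have "pbar \<le> (\<integral>\<omega>. b \<partial>M)"
    unfolding pbar_def using pb by (intro integral_mono_AE env_p_integrable[OF env]) auto
  then have pbarb: "pbar \<le> b" by (simp add: prob_space)
  note slope = env_Psi_right_le[OF env b_def _ x_pos y_pos lim_right, folded pbar_def]
  have large: "Psi_right \<le> x" using slope[of 1] by simp
  have right: "Psi_right \<le> b * x + 2 * sqrt (pbar * (1 - b) * x * y)"
  \<comment> \<open>For \<open>b = 1\<close> no slope lies strictly between \<open>b\<close> and 1,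
    and the trivial bound \<open>x\<close> is the claim. Otherwise \<open>a = b + s\<close> with
    \<open>s < 1 - b\<close>, and at \<open>u = 1 - b\<close> the bound \<open>large\<close> is
    again \<open>x\<close>.\<close>
  proof (cases "b = 1")
    case True
    then show ?thesis using large by simp
  next
    case False
    have "0 \<le> pbar * (1 - b)" using pbar0 b1 by simp
    then show ?thesis
    proof (rule le_two_sqrt_of_slope_bounds[where u = "1 - b"])
      fix s assume s: "0 < s" "s < 1 - b"
      have "Psi_right \<le> (b + s) * x + pbar * (1 - (b + s)) / s * y"
        using slope[of "b + s"] s by simp
      also have "\<dots> \<le> (b + s) * x + pbar * (1 - b) / s * y"
        using s pbar0 y_pos by (intro add_left_mono mult_right_mono divide_right_mono mult_left_mono) auto
      finally show "Psi_right \<le> b * x + s * x + pbar * (1 - b) / s * y" by (simp add: algebra_simps)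
    qed (use b1 False pbar0 x_pos y_pos large in \<open>auto simp: algebra_simps\<close>)
  qed
  have v0: "0 \<le> pbar * (1 - pbar)" using pbar0 pbarb b1 by simp
  have up: "Psi_up \<le> pbar * y + 2 * sqrt (pbar * (1 - pbar) * x * y)"
  proof -
    have small: "Psi_up \<le> pbar * y + s * x + pbar * (1 - pbar) / s * y" if "0 < s" for s
      using env_Psi_up_le[OF env pbar_def that x_pos y_pos lim_up] by (simp add: algebra_simps)
    \<comment> \<open>Every positive \<open>s\<close> is allowed here, so \<open>u\<close> is just
      taken large enough to make the bound at \<open>u\<close> trivial.\<close>
    define u where "u = \<bar>Psi_up - pbar * y\<bar> / x + 1"
    have "0 < u" using x_pos by (simp add: u_def add_nonneg_pos)
    moreover have "Psi_up \<le> pbar * y + u * x" using x_pos by (simp add: u_def distrib_right)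
    ultimately show ?thesis
      using small v0 x_pos y_pos by (intro le_two_sqrt_of_slope_bounds[where u = u]) auto
  qed
  have "Psi \<le> Psi_right + Psi_up"
    by (rule env_Psi_le_sum[OF env lim_right lim_up lim_nn])
  \<comment> \<open>Since \<open>pbar \<le> b\<close>, the first root is at most the second, which
    merges the two into the factor 4.\<close>
  moreover have "sqrt (pbar * (1 - b) * x * y) \<le> sqrt (pbar * (1 - pbar) * x * y)"
    using pbar0 pbarb x_pos y_pos by (intro real_sqrt_le_mono mult_right_mono mult_left_mono) auto
  ultimately have "Psi \<le> pbar * y + 4 * sqrt (pbar * (1 - pbar) * x * y) + b * x"
    using right up by linarith
  with right up show ?thesis by blast
qed

end
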